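(* Let $K\ge1$, let $\check x_1,\dots,\check x_K\in\mathbb R^2$ be distinct, and let $\vec\theta=(\theta_1,\dots,\theta_K)\in\mathbb R^K$, $\vec\theta\ne0$. Assume (N1)–(N3), (K1)–(K3) with $M>\nu+1$, and (X1)–(X2). Then, as $\epsilon\to0$, $$\frac{\sum_{k}\sum_{j}\bigl|\sum_{i=1}^K\theta_i\,\mathcal H\varphi'(a_k-j+\vec\alpha_k\cdot\check x_i)\bigr|^3\,\mathbb E|\eta_{k,j}|^3}{\Bigl[\sum_{k}\sum_{j}\bigl(\sum_{i=1}^K\theta_i\,\mathcal H\varphi'(a_k-j+\vec\alpha_k\cdot\check x_i)\bigr)^2\,\mathbb E\eta_{k,j}^2\Bigr]^{3/2}}=O(\epsilon^{1/2}).$$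
   Context: Fix $\kappa>0$ and $\bar p\in\mathbb R$. For $\epsilon>0$ set $\Delta p=\epsilon$, $\Delta\alpha=\kappa\epsilon$, $\alpha_k=k\Delta\alpha$, $p_j=\bar p+j\epsilon$ ($k,j\in\mathbb Z$), and $\vec\alpha=(\cos\alpha,\sin\alpha)$. Sums over $k$ range over all $k\in\mathbb Z$ with $|\alpha_k|\le\pi$; sums over $j$ range over $\mathbb Z$. Noise: for each $\epsilon$, $\{\eta_{k,j}\}$ are independent real random variables (not necessarily identically distributed) with (N1) $\mathbb E\eta_{k,j}=0$; (N2) $\mathbb E\eta_{k,j}^2=\sigma^2(\alpha_k,p_j)\Delta\alpha$, where $\sigma$ is a fixed real function of $(\alpha,p)$, $2\pi$-periodic in $\alpha$, of class $C^1$, bounded with bounded first partial derivatives on the relevant domain; (N3) $\mathbb E|\eta_{k,j}|^3\le c(\Delta\alpha)^{3/2}$ with $c$ independent of $k,j,\epsilon$. Kernel $\varphi:\mathbb R\to\mathbb R$: (K1) compactly supported; (K2) $\varphi^{(M+1)}\in L^\infty(\mathbb R)$ for some integer $M\ge3$; (K3) $\int\varphi=1$. $\mathcal H$ is the Hilbert transform, $\mathcal Hg(t)=\frac1\pi\,\mathrm{p.v.}\!\int\frac{g(s)}{t-s}ds$. For $x_0\in\mathbb R^2$ set $a_k=(\vec\alpha_k\cdot x_0-\bar p)/\epsilon$. For $r\in\mathbb R$, $\langle r\rangle=\operatorname{dist}(r,\mathbb Z)$. An irrational $s$ is of type $\nu>0$ if for every $\nu_1>\nu$ there is $c(s,\nu_1)>0$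 with $m^{\nu_1}\langle ms\rangle\ge c(s,\nu_1)$ for all $m\in\mathbb N$. (X1) $\kappa|x_0|$ is irrational and of some finite type $\nu$; (X2) $\sigma^2(\alpha,\vec\alpha\cdot x_0)\neq0$ for all $\alpha$ in some nonempty open set $\Omega\subset[0,2\pi]$. *)

theory Defs
  imports "HOL-Probability.Probability" "HOL-Library.Landau_Symbols"
begin

definition dist_int :: "real \<Rightarrow> real" where
  "dist_int r = \<bar>r - of_int (round r)\<bar>"

definition irrational_of_type :: "real \<Rightarrow> real \<Rightarrow> bool" where
  "irrational_of_type s \<nu> \<longleftrightarrow> s \<notin> \<rat> \<and>
     (\<forall>\<nu>1>\<nu>. \<exists>c>0. \<forall>m::nat. m \<ge> 1 \<longrightarrow> real m powr \<nu>1 * dist_int (real m * s) \<ge> c)"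

definition hilbert :: "(real \<Rightarrow> real) \<Rightarrow> real \<Rightarrow> real" where
  "hilbert g t = (1 / pi) *
     Lim (at_right 0) (\<lambda>\<delta>. LINT s:{s. \<delta> \<le> \<bar>t - s\<bar>}|lborel. g s / (t - s))"

definition dirvec :: "real \<Rightarrow> real \<times> real" where
  "dirvec \<alpha> = (cos \<alpha>, sin \<alpha>)"

end

theory Submission
  imports Defs
begin

text \<open>
  Write \<open>h\<close> for the Hilbert transform of \<open>\<phi>'\<close>; it is continuous and \<open>O(1/(1+t\<^sup>2))\<close>. Hence each inner sum
  in the numerator is \<open>O(\<epsilon>\<^bsup>3/2\<^esup>)\<close>, and as there are \<open>O(1/\<epsilon>)\<close> angles, the numerator is \<open>O(\<epsilon>\<^bsup>1/2\<^esup>)\<close>.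
  It remains to bound the denominator away from zero.

  Fix an angle at which the numbers \<open>b\<^sub>i = \<alpha> \<cdot> x\<^sub>i\<close> are distinct, which excludes only countably many angles.
  For every phase \<open>s\<close> some integer \<open>j\<close> satisfies \<open>\<Sum>\<^sub>i \<theta>\<^sub>i h(s - j + b\<^sub>i) \<noteq> 0\<close>. Otherwise the Cauchy transform
  of \<open>\<Phi> = \<Sum>\<^sub>i \<theta>\<^sub>i \<phi>'(\<cdot> + b\<^sub>i)\<close> would have zeros accumulating at infinity, so all moments of \<open>\<Phi>\<close> would
  vanish, so \<open>\<Phi> = 0\<close> by the Weierstrass approximation theorem; but distinct translates of a nonzero
  compactly supported function are linearly independent. By compactness in \<open>s \<in> [0,1]\<close> and
  continuity in the angle, finitely many \<open>j\<close> give a uniform lower bound on a whole interval of angles,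
  irrespective of how the phases \<open>a\<^sub>k\<close> are distributed modulo 1. That interval contains a positive
  proportion of the \<open>\<alpha>\<^sub>k\<close>, and \<open>\<sigma>\<close> is bounded away from zero at the relevant points.
\<close>

section \<open>The Hilbert transform of a compactly supported Lipschitz function\<close>

lemma integrable_bounded_support:
  fixes f :: "real \<Rightarrow> real"
  assumes [measurable]: "f \<in> borel_measurable borel"
    and "\<And>x. \<bar>f x\<bar> \<le> B" and "\<And>x. \<bar>x\<bar> > R \<Longrightarrow> f x = 0"
  shows "integrable lborel f"
proof (rule Bochner_Integration.integrable_bound)
  show "integrable lborel (\<lambda>x. B * indicator {-R..R} x :: real)"
    by (intro integrable_mult_right integrable_real_indicator) (auto simp: emeasure_lborel_Icc_eq)
  show "AE x in lborel. norm (f x) \<le> norm (B * indicator {-R..R} x :: real)"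
  proof (rule AE_I2)
    fix x
    show "norm (f x) \<le> norm (B * indicator {-R..R} x :: real)"
      using assms(2)[of x] assms(3)[of x] by (auto simp: indicator_def)
  qed
qed simp

lemma integral_abs_bounded_support:
  fixes f :: "real \<Rightarrow> real"
  assumes "f \<in> borel_measurable borel" "R \<ge> 0"
    and "\<And>x. \<bar>f x\<bar> \<le> B" and "\<And>x. \<bar>x\<bar> > R \<Longrightarrow> f x = 0"
  shows "\<bar>integral\<^sup>L lborel f\<bar> \<le> 2 * R * B"
proof -
  have "\<bar>integral\<^sup>L lborel f\<bar> \<le> (\<integral>x. \<bar>f x\<bar> \<partial>lborel)"
    using integral_norm_bound[of lborel f] by simp
  also have "\<dots> \<le> (\<integral>x. B * indicator {-R..R} x \<partial>lborel)"
  proof (rule integral_mono)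
    show "integrable lborel (\<lambda>x. \<bar>f x\<bar>)"
      using integrable_bounded_support[OF assms(1,3,4)] by (rule integrable_abs)
    show "integrable lborel (\<lambda>x. B * indicator {-R..R} x :: real)"
      by (intro integrable_mult_right integrable_real_indicator) (auto simp: emeasure_lborel_Icc_eq)
    show "\<bar>f x\<bar> \<le> B * indicator {-R..R} x" for x
      using assms(3)[of x] assms(4)[of x] by (auto simp: indicator_def)
  qed
  also have "\<dots> = 2 * R * B" using assms(2) by simp
  finally show ?thesis .
qed

text \<open>The class in which \<open>deriv \<phi>\<close> will be placed: the Lipschitz bound tames
  the singularity of the Hilbert kernel, the bounded support controls infinity.\<close>

locale lipschitz_bump =
  fixes g :: "real \<Rightarrow> real" and L R :: real
  assumes lip: "\<And>x y. \<bar>g x - g y\<bar> \<le> L * \<bar>x - y\<bar>"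
    and supp: "\<And>x. \<bar>x\<bar> > R \<Longrightarrow> g x = 0"
    and R_nonneg: "R \<ge> 0"
begin

lemma L_nonneg: "L \<ge> 0"
  using lip[of 0 1] by simp

lemma cont: "continuous_on UNIV g"
proof -
  have "L-lipschitz_on UNIV g"
    using lip L_nonneg by (auto simp: lipschitz_on_def dist_real_def)
  then show ?thesis by (rule lipschitz_on_continuous_on)
qed

lemma meas [measurable]: "g \<in> borel_measurable borel"
  using cont by (rule borel_measurable_continuous_onI)

lemma bounded: "\<bar>g x\<bar> \<le> L * (2 * R + 1)"
proof (cases "\<bar>x\<bar> > R")
  case True
  then show ?thesis using L_nonneg R_nonneg by (simp add: supp)
next
  case False
  have "\<bar>g x - g (R + 1)\<bar> \<le> L * \<bar>x - (R + 1)\<bar>" by (rule lip)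
  also have "\<dots> \<le> L * (2 * R + 1)"
    using False L_nonneg by (intro mult_left_mono) auto
  finally show ?thesis using R_nonneg by (simp add: supp)
qed

text \<open>Pairing the points \<open>t - u\<close> and \<open>t + u\<close> cancels the odd
  singularity, so the principal value becomes an ordinary Lebesgue integral over
  \<open>u > 0\<close>.\<close>

definition sym_quot :: "real \<Rightarrow> real \<Rightarrow> real" where
  "sym_quot t u = (g (t - u) - g (t + u)) / u"

lemma sym_quot_meas [measurable]: "sym_quot t \<in> borel_measurable borel"
  unfolding sym_quot_def by measurable

lemma sym_quot_bound: "\<bar>sym_quot t u\<bar> \<le> 2 * L"
proof (cases "u = 0")
  case False
  have "\<bar>g (t - u) - g (t + u)\<bar> \<le> L * \<bar>(t - u) - (t + u)\<bar>" by (rule lip)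
  also have "\<dots> = 2 * L * \<bar>u\<bar>" by (simp add: abs_if)
  finally show ?thesis using False by (simp add: sym_quot_def abs_divide divide_le_eq)
qed (simp add: sym_quot_def L_nonneg)

lemma sym_quot_supp: "\<bar>u\<bar> > R + \<bar>t\<bar> \<Longrightarrow> sym_quot t u = 0"
  unfolding sym_quot_def by (subst (1 2) supp) auto

text \<open>Substitute \<open>s = t - u\<close> and reflect the half-line of negative
  \<open>u\<close> onto the positive one; the sign of \<open>1 / u\<close> turns the sum of the two
  halves into a difference.\<close>

lemma truncated_integral:
  assumes "\<delta> > 0"
  shows "(LINT s:{s. \<delta> \<le> \<bar>t - s\<bar>}|lborel. g s / (t - s)) =
    (\<integral>u. indicator {\<delta>..} u * sym_quot t u \<partial>lborel)"
proof -
  \<comment> \<open>One bound for all three integrability claims: on the truncated range the kernel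
    is at most \<open>1 / \<delta>\<close>.\<close>
  have gb: "\<bar>indicator A u * (g v / u)\<bar> \<le> L * (2 * R + 1) / \<delta>"
    if "u \<in> A \<longrightarrow> \<bar>u\<bar> \<ge> \<delta>" for u v and A :: "real set"
  proof (cases "u \<in> A")
    case True
    then have "\<bar>g v\<bar> / \<bar>u\<bar> \<le> L * (2 * R + 1) / \<delta>"
      using that assms bounded[of v] by (intro frac_le) auto
    with True show ?thesis by (simp add: abs_divide)
  qed (use L_nonneg R_nonneg assms in simp)
  have int1: "integrable lborel (\<lambda>u. indicator {\<delta>..} u * (g (t - u) / u))"
    by (rule integrable_bounded_support[where B = "L * (2 * R + 1) / \<delta>" and R = "R + \<bar>t\<bar>"])
      (use assms in \<open>auto intro!: gb simp: supp simp del: times_divide_eq_right\<close>)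
  have int2: "integrable lborel (\<lambda>u. indicator {..-\<delta>} u * (g (t - u) / u))"
    by (rule integrable_bounded_support[where B = "L * (2 * R + 1) / \<delta>" and R = "R + \<bar>t\<bar>"])
      (use assms in \<open>auto intro!: gb simp: supp simp del: times_divide_eq_right\<close>)
  have int3: "integrable lborel (\<lambda>u. indicator {\<delta>..} u * (g (t + u) / u))"
    by (rule integrable_bounded_support[where B = "L * (2 * R + 1) / \<delta>" and R = "R + \<bar>t\<bar>"])
      (use assms in \<open>auto intro!: gb simp: supp simp del: times_divide_eq_right\<close>)
  have "(LINT s:{s. \<delta> \<le> \<bar>t - s\<bar>}|lborel. g s / (t - s)) =
    (\<integral>u. indicator {s. \<delta> \<le> \<bar>t - s\<bar>} (t + (-1) * u) * (g (t + (-1) * u) / (t - (t + (-1) * u))) \<partial>lborel)"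
    unfolding set_lebesgue_integral_def
    by (subst lborel_integral_real_affine[where c = "-1" and t = t]) auto
  also have "\<dots> = (\<integral>u. indicator {\<delta>..} u * (g (t - u) / u) + indicator {..-\<delta>} u * (g (t - u) / u) \<partial>lborel)"
    by (rule Bochner_Integration.integral_cong) (use assms in \<open>auto simp: indicator_def\<close>)
  also have "\<dots> = (\<integral>u. indicator {\<delta>..} u * (g (t - u) / u) \<partial>lborel) +
      (\<integral>u. indicator {..-\<delta>} u * (g (t - u) / u) \<partial>lborel)"
    by (rule Bochner_Integration.integral_add[OF int1 int2])
  also have "(\<integral>u. indicator {..-\<delta>} u * (g (t - u) / u) \<partial>lborel) =
      (\<integral>u. indicator {..-\<delta>} (0 + (-1) * u) * (g (t - (0 + (-1) * u)) / (0 + (-1) * u)) \<partial>lborel)"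
    by (subst lborel_integral_real_affine[where c = "-1" and t = 0]) auto
  also have "\<dots> = (\<integral>u. - (indicator {\<delta>..} u * (g (t + u) / u)) \<partial>lborel)"
    by (rule Bochner_Integration.integral_cong) (auto simp: indicator_def)
  also have "(\<integral>u. indicator {\<delta>..} u * (g (t - u) / u) \<partial>lborel) + \<dots> =
     (\<integral>u. indicator {\<delta>..} u * (g (t - u) / u) + - (indicator {\<delta>..} u * (g (t + u) / u)) \<partial>lborel)"
    using int1 int3 by (subst Bochner_Integration.integral_add) auto
  also have "\<dots> = (\<integral>u. indicator {\<delta>..} u * sym_quot t u \<partial>lborel)"
    by (rule Bochner_Integration.integral_cong) (auto simp: sym_quot_def field_simps diff_divide_distrib)
  finally show ?thesis .
qed

text \<open>Dominated convergence as the truncation shrinks, with the absolute value of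
  \<open>sym_quot t\<close> as dominating function. This also shows that the limit exists, so that
  \<open>Lim\<close> in the definition of \<open>hilbert\<close> denotes it.\<close>

lemma hilbert_eq_sym_quot:
  "hilbert g t = (1 / pi) * (\<integral>u. indicator {0<..} u * sym_quot t u \<partial>lborel)"
proof -
  have "((\<lambda>\<delta>. \<integral>u. indicator {\<delta>..} u * sym_quot t u \<partial>lborel) \<longlongrightarrow>
      (\<integral>u. indicator {0<..} u * sym_quot t u \<partial>lborel)) (at_right 0)"
    unfolding tendsto_at_iff_sequentially
  proof (intro allI impI)
    fix X :: "nat \<Rightarrow> real"
    assume X: "\<forall>i. X i \<in> {0<..} - {0}" "X \<longlonglongrightarrow> 0"
    show "((\<lambda>\<delta>. \<integral>u. indicator {\<delta>..} u * sym_quot t u \<partial>lborel) \<circ> X) \<longlonglongrightarrow>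
      (\<integral>u. indicator {0<..} u * sym_quot t u \<partial>lborel)"
      unfolding o_def
    proof (rule integral_dominated_convergence[where w = "\<lambda>u. \<bar>sym_quot t u\<bar>"])
      show "integrable lborel (\<lambda>u. \<bar>sym_quot t u\<bar>)"
        using integrable_bounded_support[OF sym_quot_meas sym_quot_bound sym_quot_supp]
        by (rule integrable_abs)
      show "AE u in lborel. (\<lambda>n. indicator {X n..} u * sym_quot t u) \<longlonglongrightarrow> indicator {0<..} u * sym_quot t u"
      proof (intro AE_I2 tendsto_eventually)
        fix u :: real
        show "eventually (\<lambda>n. indicator {X n..} u * sym_quot t u = indicator {0<..} u * sym_quot t u) sequentially"
        proof (cases "u > 0")
          case True
          then have "eventually (\<lambda>n. X n < u) sequentially"
            using X(2) order_tendstoD(2) by blast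
          then show ?thesis
            by eventually_elim (use True in \<open>auto simp: indicator_def\<close>)
        next
          case False
          then have "u \<notin> {X n..}" for n using X(1)[rule_format, of n] by auto
          with False show ?thesis by simp
        qed
      qed
    qed (auto simp: indicator_def)
  qed
  then have "((\<lambda>\<delta>. LINT s:{s. \<delta> \<le> \<bar>t - s\<bar>}|lborel. g s / (t - s)) \<longlongrightarrow>
      (\<integral>u. indicator {0<..} u * sym_quot t u \<partial>lborel)) (at_right 0)"
    by (rule Lim_transform_eventually)
      (auto simp: eventually_at_right_less truncated_integral intro!: eventually_mono[OF eventually_at_right_less])
  then have "Lim (at_right 0) (\<lambda>\<delta>. LINT s:{s. \<delta> \<le> \<bar>t - s\<bar>}|lborel. g s / (t - s)) =
      (\<integral>u. indicator {0<..} u * sym_quot t u \<partial>lborel)"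
    by (intro tendsto_Lim) auto
  then show ?thesis by (simp add: hilbert_def)
qed

text \<open>A convergent sequence of arguments is bounded by some \<open>A\<close>, so all the
  symmetric quotients share the dominating function \<open>2 * L\<close> on a fixed compact
  interval.\<close>

lemma continuous_hilbert: "continuous_on UNIV (hilbert g)"
proof -
  have "isCont (hilbert g) t" for t
    unfolding continuous_at_sequentially
  proof (intro allI impI)
    fix X :: "nat \<Rightarrow> real"
    assume X: "X \<longlonglongrightarrow> t"
    then obtain A where A: "\<And>n. \<bar>X n\<bar> \<le> A"
      using convergent_imp_Bseq[OF convergentI[OF X]] by (auto simp: Bseq_def)
    have "(\<lambda>n. \<integral>u. indicator {0<..} u * sym_quot (X n) u \<partial>lborel) \<longlonglongrightarrow>
        (\<integral>u. indicator {0<..} u * sym_quot t u \<partial>lborel)"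
    proof (rule integral_dominated_convergence[where w = "\<lambda>u. 2 * L * indicator {-(R+A)..R+A} u"])
      show "integrable lborel (\<lambda>u. 2 * L * indicator {-(R+A)..R+A} u :: real)"
        by (intro integrable_mult_right integrable_real_indicator) (auto simp: emeasure_lborel_Icc_eq)
      show "AE u in lborel. (\<lambda>n. indicator {0<..} u * sym_quot (X n) u) \<longlonglongrightarrow> indicator {0<..} u * sym_quot t u"
        unfolding sym_quot_def divide_inverse
        by (intro AE_I2 tendsto_intros isCont_tendsto_compose[of _ g] X)
          (use cont in \<open>auto simp: continuous_on_eq_continuous_at\<close>)
      show "AE u in lborel. norm (indicator {0<..} u * sym_quot (X n) u) \<le> 2 * L * indicator {-(R+A)..R+A} u" for n
        using sym_quot_bound[of "X n"] sym_quot_supp[of "X n"] A[of n] L_nonneg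
        by (intro AE_I2) (fastforce simp: indicator_def abs_mult abs_le_iff)
    qed auto
    then show "(hilbert g \<circ> X) \<longlonglongrightarrow> hilbert g t"
      unfolding o_def hilbert_eq_sym_quot by (intro tendsto_intros)
  qed
  then show ?thesis by (simp add: continuous_on_eq_continuous_at)
qed

text \<open>Outside the support there is no singularity: once \<open>\<delta>\<close> is below the
  distance from \<open>t\<close> to the support, truncation removes only points where
  \<open>g\<close> vanishes.\<close>

lemma hilbert_far:
  assumes "\<bar>t\<bar> > R"
  shows "hilbert g t = (1 / pi) * (\<integral>s. g s / (t - s) \<partial>lborel)"
proof -
  have "((\<lambda>\<delta>. LINT s:{s. \<delta> \<le> \<bar>t - s\<bar>}|lborel. g s / (t - s)) \<longlongrightarrow>
      (\<integral>s. g s / (t - s) \<partial>lborel)) (at_right 0)"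
  proof (rule tendsto_eventually)
    have "eventually (\<lambda>\<delta>. \<delta> < \<bar>t\<bar> - R) (at_right (0::real))"
      using assms by (intro order_tendstoD(2)[OF tendsto_ident_at]) auto
    then show "eventually (\<lambda>\<delta>. (LINT s:{s. \<delta> \<le> \<bar>t - s\<bar>}|lborel. g s / (t - s)) =
      (\<integral>s. g s / (t - s) \<partial>lborel)) (at_right 0)"
    proof eventually_elim
      case (elim \<delta>)
      have "\<delta> \<le> \<bar>t - s\<bar> \<or> g s = 0" for s
        using elim supp[of s] by linarith
      then show ?case
        unfolding set_lebesgue_integral_def
        by (intro Bochner_Integration.integral_cong) (auto simp: indicator_def)
    qed
  qed
  then have "Lim (at_right 0) (\<lambda>\<delta>. LINT s:{s. \<delta> \<le> \<bar>t - s\<bar>}|lborel. g s / (t - s)) =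
      (\<integral>s. g s / (t - s) \<partial>lborel)"
    by (intro tendsto_Lim) auto
  then show ?thesis by (simp add: hilbert_def)
qed

text \<open>Since \<open>g\<close> has mean zero, \<open>g s / t\<close> may be subtracted from the
  integrand. The kernel then becomes \<open>s / (t * (t - s))\<close>, which gains one power of
  \<open>t\<close>; the remaining compact range of \<open>t\<close> is covered by
  continuity.\<close>

lemma hilbert_decay:
  assumes zero: "integral\<^sup>L lborel g = 0"
  obtains C where "C > 0" "\<And>t. \<bar>hilbert g t\<bar> \<le> C / (1 + t\<^sup>2)"
proof -
  define B where "B = L * (2 * R + 1)"
  have B: "\<bar>g x\<bar> \<le> B" for x using bounded by (simp add: B_def)
  have B0: "B \<ge> 0" using B[of 0] by linarith
  have int_g: "integrable lborel g"
    by (rule integrable_bounded_support[OF meas B supp])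
  \<comment> \<open>For \<open>t\<close> beyond this threshold and \<open>s\<close> in the support,
    the distance from \<open>t\<close> to \<open>s\<close> is at least half of the modulus of
    \<open>t\<close>; the extra 1 makes \<open>t\<^sup>2\<close> comparable with
    \<open>1 + t\<^sup>2\<close>.\<close>
  define T where "T = 2 * R + 1"
  have far: "\<bar>hilbert g t\<bar> \<le> 8 * R * R * B / (1 + t\<^sup>2)" if t: "\<bar>t\<bar> \<ge> T" for t
  proof -
    have tR: "\<bar>t\<bar> > R" "\<bar>t\<bar> \<ge> 1" using t R_nonneg by (auto simp: T_def)
    have t0: "t \<noteq> 0" using tR by auto
    have eq: "g s / (t - s) - g s / t = g s * s / (t - s) / t" for s
    proof (cases "\<bar>s\<bar> > R")
      case False
      then have "t - s \<noteq> 0" using tR by auto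
      with t0 show ?thesis by (simp add: field_simps)
    qed (simp add: supp)
    have bd: "\<bar>g s * s / (t - s) / t\<bar> \<le> 2 * R * B / t\<^sup>2" for s
    proof (cases "\<bar>s\<bar> > R")
      case False
      then have "\<bar>t - s\<bar> \<ge> \<bar>t\<bar> / 2" using t unfolding T_def by linarith
      then have "\<bar>t - s\<bar> * \<bar>t\<bar> \<ge> \<bar>t\<bar> / 2 * \<bar>t\<bar>" by (rule mult_right_mono) auto
      then have "\<bar>t - s\<bar> * \<bar>t\<bar> \<ge> t\<^sup>2 / 2" by (simp add: power2_eq_square)
      then have "\<bar>g s\<bar> * \<bar>s\<bar> / (\<bar>t - s\<bar> * \<bar>t\<bar>) \<le> B * R / (t\<^sup>2 / 2)"
        using B[of s] B0 False t0 R_nonneg by (intro frac_le mult_mono) auto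
      then show ?thesis by (simp add: abs_mult mult_ac)
    qed (use B0 R_nonneg in \<open>simp add: supp\<close>)
    have int1: "integrable lborel (\<lambda>s. g s * s / (t - s) / t)"
      by (rule integrable_bounded_support[OF _ bd, where R = R]) (auto simp: supp)
    have "integrable lborel (\<lambda>s. g s / t + g s * s / (t - s) / t)"
      using int1 int_g by auto
    moreover have "g s / t + g s * s / (t - s) / t = g s / (t - s)" for s
      using eq[of s] by linarith
    ultimately have int2: "integrable lborel (\<lambda>s. g s / (t - s))" by (simp only:)
    have "(\<integral>s. g s / (t - s) \<partial>lborel) = (\<integral>s. g s / (t - s) - g s / t \<partial>lborel)"
      using int2 int_g zero by simp
    also have "\<dots> = (\<integral>s. g s * s / (t - s) / t \<partial>lborel)" by (simp only: eq)
    finally have "\<bar>\<integral>s. g s / (t - s) \<partial>lborel\<bar> \<le> 2 * R * (2 * R * B / t\<^sup>2)"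
      using integral_abs_bounded_support[OF _ R_nonneg bd] by (simp add: supp)
    also have "\<dots> = 8 * R * R * B / (2 * t\<^sup>2)" by simp
    also have "\<dots> \<le> 8 * R * R * B / (1 + t\<^sup>2)"
    proof -
      have "1 + t\<^sup>2 \<le> 2 * t\<^sup>2" using tR(2) by (simp add: abs_le_square_iff[of 1 t, simplified])
      then show ?thesis using R_nonneg B0 t0
        by (intro divide_left_mono) (auto intro!: mult_nonneg_nonneg mult_pos_pos add_pos_nonneg)
    qed
    finally have 1: "\<bar>\<integral>s. g s / (t - s) \<partial>lborel\<bar> \<le> 8 * R * R * B / (1 + t\<^sup>2)" .
    have "\<bar>hilbert g t\<bar> = (1 / pi) * \<bar>\<integral>s. g s / (t - s) \<partial>lborel\<bar>"
      by (simp add: hilbert_far[OF tR(1)] abs_mult)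
    also have "\<dots> \<le> 1 * \<bar>\<integral>s. g s / (t - s) \<partial>lborel\<bar>"
      using pi_gt3 by (intro mult_right_mono) auto
    finally show ?thesis using 1 by simp
  qed
  have "compact (hilbert g ` {-T..T})"
    by (intro compact_continuous_image continuous_on_subset[OF continuous_hilbert]) auto
  then obtain H where H: "\<And>t. \<bar>t\<bar> \<le> T \<Longrightarrow> \<bar>hilbert g t\<bar> \<le> H"
    by (fastforce dest!: compact_imp_bounded simp: bounded_iff abs_le_iff)
  have T0: "T \<ge> 0" using R_nonneg by (simp add: T_def)
  have H0: "H \<ge> 0" using H[of 0] T0 by force
  define C where "C = 8 * R * R * B + H * (1 + T\<^sup>2) + 1"
  have C0: "8 * R * R * B \<ge> 0" "H * (1 + T\<^sup>2) \<ge> 0"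
    using B0 R_nonneg H0 by (auto intro!: mult_nonneg_nonneg)
  show thesis
  proof
    show "C > 0" using C0 unfolding C_def by linarith
    show "\<bar>hilbert g t\<bar> \<le> C / (1 + t\<^sup>2)" for t
    proof (cases "\<bar>t\<bar> \<ge> T")
      case True
      have "8 * R * R * B / (1 + t\<^sup>2) \<le> C / (1 + t\<^sup>2)"
        using C0 by (intro divide_right_mono) (auto simp: C_def)
      with far[OF True] show ?thesis by linarith
    next
      case False
      then have "t\<^sup>2 \<le> T\<^sup>2" using T0 by (simp flip: abs_le_square_iff)
      then have "\<bar>hilbert g t\<bar> * (1 + t\<^sup>2) \<le> H * (1 + T\<^sup>2)"
        using H[of t] False H0 by (intro mult_mono) auto
      then have "\<bar>hilbert g t\<bar> * (1 + t\<^sup>2) \<le> C" using C0 unfolding C_def by linarith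
      then show ?thesis by (simp add: pos_le_divide_eq add_pos_nonneg)
    qed
  qed
qed

end

section \<open>Non-vanishing along integer shifts\<close>

text \<open>Unlike the Lipschitz bound with its fixed constant, these properties survive
  multiplication by any continuous function with the same \<open>R\<close>, which the moment
  argument needs for monomials and polynomials.\<close>

locale continuous_bump =
  fixes f :: "real \<Rightarrow> real" and R :: real
  assumes cont: "continuous_on UNIV f"
    and supp: "\<And>x. \<bar>x\<bar> > R \<Longrightarrow> f x = 0"
    and R_nonneg: "R \<ge> 0"
begin

lemma meas [measurable]: "f \<in> borel_measurable borel"
  using cont by (rule borel_measurable_continuous_onI)

lemma bounded: obtains B where "B > 0" "\<And>x. \<bar>f x\<bar> \<le> B"
proof -
  have "compact (f ` {-R..R})"
    by (intro compact_continuous_image continuous_on_subset[OF cont]) auto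
  then obtain b where "\<And>x. \<bar>x\<bar> \<le> R \<Longrightarrow> \<bar>f x\<bar> \<le> b"
    by (fastforce dest!: compact_imp_bounded simp: bounded_iff abs_le_iff)
  then have "\<bar>f x\<bar> \<le> max b 0 + 1" for x
    using supp[of x] by (cases "\<bar>x\<bar> > R") (force simp: not_less)+
  then show ?thesis by (intro that[of "max b 0 + 1"]) auto
qed

lemma integrable: "integrable lborel f"
  using bounded by (metis integrable_bounded_support meas supp)

lemma times_continuous: "continuous_on UNIV p \<Longrightarrow> continuous_bump (\<lambda>x. f x * p x) R"
  by unfold_locales (auto intro!: continuous_intros cont simp: supp R_nonneg)

text \<open>On the support \<open>x\<close> is at most \<open>t / 2\<close>. The constant 2 does not
  depend on \<open>t\<close>, so it yields a dominating function for the limit of large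
  \<open>t\<close>.\<close>

lemma cauchy_kernel_bound:
  assumes "t \<ge> 2 * R + 1"
  shows "\<bar>f x * (t / (t - x))\<bar> \<le> \<bar>f x\<bar> * 2"
proof (cases "\<bar>x\<bar> > R")
  case False
  then have "t - x > 0" using assms R_nonneg by linarith
  moreover have "t \<le> 2 * (t - x)" using False assms abs_ge_self[of x] by (simp add: field_simps)
  moreover have "t > 0" using assms R_nonneg by linarith
  ultimately have "\<bar>t / (t - x)\<bar> \<le> 2" by (simp add: divide_le_eq)
  then show ?thesis unfolding abs_mult by (intro mult_left_mono) auto
qed (simp add: supp)

lemma integrable_cauchy:
  assumes "t \<ge> 2 * R + 1"
  shows "integrable lborel (\<lambda>x. f x / (t - x))"
proof -
  have "integrable lborel (\<lambda>x. f x * (t / (t - x)))"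
    by (rule Bochner_Integration.integrable_bound[of _ "\<lambda>x. f x * 2"])
      (use integrable cauchy_kernel_bound[OF assms] in \<open>auto intro!: AE_I2 simp: abs_mult\<close>)
  then have "integrable lborel (\<lambda>x. f x * (t / (t - x)) / t)" by (intro integrable_divide_zero)
  moreover have "t \<noteq> 0" using assms R_nonneg by linarith
  ultimately show ?thesis by simp
qed

text \<open>The leading Laurent coefficient of a Cauchy transform at infinity is the total integral:
  the factor \<open>t / (t - x) = 1 + x / (t - x)\<close> tends to 1 pointwise and is dominated on
  the support.\<close>

lemma cauchy_transform_at_infinity:
  assumes X: "filterlim X at_top sequentially" and X_ge: "\<And>n. X n \<ge> 2 * R + 1"
  shows "(\<lambda>n. \<integral>x. f x * (X n / (X n - x)) \<partial>lborel) \<longlonglongrightarrow> integral\<^sup>L lborel f"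
proof (rule integral_dominated_convergence[where w = "\<lambda>x. \<bar>f x\<bar> * 2"])
  show "integrable lborel (\<lambda>x. \<bar>f x\<bar> * 2)" using integrable by simp
  show "AE x in lborel. (\<lambda>n. f x * (X n / (X n - x))) \<longlonglongrightarrow> f x"
  proof (rule AE_I2)
    fix x :: real
    have "(\<lambda>n. 1 + x * inverse (- x + X n)) \<longlonglongrightarrow> 1 + x * 0"
      by (intro tendsto_intros tendsto_inverse_0_at_top
          filterlim_tendsto_add_at_top[OF tendsto_const] X)
    then have "(\<lambda>n. f x * (1 + x * inverse (- x + X n))) \<longlonglongrightarrow> f x * (1 + x * 0)"
      by (rule tendsto_mult_left)
    moreover have "f x * (1 + x * inverse (- x + X n)) = f x * (X n / (X n - x))" for n
    proof (cases "\<bar>x\<bar> > R")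
      case False
      then have "X n - x \<noteq> 0" using X_ge[of n] R_nonneg by linarith
      then show ?thesis by (simp add: field_simps)
    qed (simp add: supp)
    ultimately show "(\<lambda>n. f x * (X n / (X n - x))) \<longlonglongrightarrow> f x" by simp
  qed
qed (use cauchy_kernel_bound[OF X_ge] in auto)

text \<open>Zeros of the Cauchy transform accumulating at infinity annihilate its Laurent coefficients,
  that is the moments, one after the other, because
  \<^term>\<open>x ^ Suc n / (t - x) = t * (x ^ n / (t - x)) - x ^ n\<close>.\<close>

lemma moments_zero:
  assumes X: "filterlim X at_top sequentially" and X_ge: "\<And>n. X n \<ge> 2 * R + 1"
    and zero: "\<And>n. (\<integral>x. f x / (X n - x) \<partial>lborel) = 0"
  shows "(\<integral>x. f x * x ^ n \<partial>lborel) = 0"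
proof -
  have bump: "continuous_bump (\<lambda>x. f x * x ^ n) R" for n
    by (intro times_continuous continuous_intros)
  \<comment> \<open>Multiplying the vanishing transform by \<open>X m\<close> keeps it zero, while
    the limit of the product is the moment.\<close>
  have moment: "(\<integral>x. f x * x ^ n \<partial>lborel) = 0"
    if "\<And>m. (\<integral>x. f x * x ^ n / (X m - x) \<partial>lborel) = 0" for n
  proof -
    have "(\<integral>x. f x * x ^ n * (X m / (X m - x)) \<partial>lborel) = X m * (\<integral>x. f x * x ^ n / (X m - x) \<partial>lborel)" for m
      by (subst integral_mult_right_zero[symmetric]) (simp add: mult_ac)
    then have "(\<integral>x. f x * x ^ n * (X m / (X m - x)) \<partial>lborel) = 0" for m
      using that by simp
    then show ?thesis
      using continuous_bump.cauchy_transform_at_infinity[OF bump X X_ge, of n]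
      by (simp add: LIMSEQ_const_iff)
  qed
  \<comment> \<open>The induction carries the vanishing of the transform of every weighted function;
    the moment of order \<open>n\<close>, needed to pass to \<open>Suc n\<close>, follows from it by
    \<open>moment\<close>.\<close>
  have "(\<integral>x. f x * x ^ n / (X m - x) \<partial>lborel) = 0" for n m
  proof (induction n arbitrary: m)
    case 0
    then show ?case using zero by simp
  next
    case (Suc n)
    have eq: "f x * x ^ Suc n / (X m - x) = X m * (f x * x ^ n / (X m - x)) - f x * x ^ n" for x
    proof (cases "\<bar>x\<bar> > R")
      case False
      then have "X m - x \<noteq> 0" using X_ge[of m] R_nonneg by linarith
      then show ?thesis by (simp add: field_simps)
    qed (simp add: supp)
    have "(\<integral>x. f x * x ^ Suc n / (X m - x) \<partial>lborel) =
        X m * (\<integral>x. f x * x ^ n / (X m - x) \<partial>lborel) - (\<integral>x. f x * x ^ n \<partial>lborel)"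
      unfolding eq
      using continuous_bump.integrable[OF bump] continuous_bump.integrable_cauchy[OF bump X_ge]
      by (subst Bochner_Integration.integral_diff) (auto simp del: times_divide_eq_right)
    also have "\<dots> = 0" using Suc.IH moment[OF Suc.IH] by simp
    finally show ?case .
  qed
  then show ?thesis by (rule moment)
qed

text \<open>Vanishing moments make \<open>f\<close> orthogonal to all polynomials. Approximating
  \<open>f\<close> itself by polynomials on its support makes the integral of its square arbitrarily
  small, which continuity excludes unless \<open>f\<close> is zero.\<close>

lemma zero_if_moments_zero:
  assumes "\<And>n. (\<integral>x. f x * x ^ n \<partial>lborel) = 0"
  shows "f x = 0"
proof (rule ccontr)
  assume nz: "f x \<noteq> 0"
  obtain B where B: "B > 0" "\<And>x. \<bar>f x\<bar> \<le> B" using bounded by blast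
  have sq: "continuous_bump (\<lambda>x. f x * f x) R" by (intro times_continuous cont)
  have le: "(\<integral>x. f x * f x \<partial>lborel) \<le> e" if "e > 0" for e
  proof -
    \<comment> \<open>Chosen so that the final error \<open>2 * R * B * d\<close> is at most
      \<open>e\<close>; the added 1 keeps the divisor positive when \<open>R = 0\<close>.\<close>
    define d where "d = e / (2 * R * B + 1)"
    have den: "2 * R * B + 1 > 0" using R_nonneg B by (auto intro!: add_nonneg_pos)
    have d: "d > 0" using that den by (simp add: d_def)
    obtain p where p: "real_polynomial_function p" "\<And>x. x \<in> {-R..R} \<Longrightarrow> \<bar>f x - p x\<bar> < d"
      by (rule Stone_Weierstrass_real_polynomial_function[of "{-R..R}" f d])
        (use d continuous_on_subset[OF cont] in auto)
    obtain a N where a: "p = (\<lambda>x. \<Sum>i\<le>(N::nat). a i * x ^ i)"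
      using real_polynomial_function_imp_sum[OF p(1)] by blast
    have cp: "continuous_on UNIV p" unfolding a by (intro continuous_intros)
    have "(\<integral>x. f x * p x \<partial>lborel) = (\<integral>x. (\<Sum>i\<le>N. a i * (f x * x ^ i)) \<partial>lborel)"
      by (simp add: a sum_distrib_left mult_ac)
    also have "\<dots> = (\<Sum>i\<le>N. a i * (\<integral>x. f x * x ^ i \<partial>lborel))"
      by (subst Bochner_Integration.integral_sum)
        (auto intro!: integrable_mult_right continuous_bump.integrable times_continuous continuous_intros)
    also have "\<dots> = 0" by (simp add: assms)
    finally have fp: "(\<integral>x. f x * p x \<partial>lborel) = 0" .
    have "(\<integral>x. f x * f x \<partial>lborel) = (\<integral>x. f x * f x - f x * p x \<partial>lborel)"
      using fp continuous_bump.integrable[OF sq] continuous_bump.integrable[OF times_continuous[OF cp]]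
      by simp
    also have "\<dots> \<le> \<bar>\<integral>x. f x * f x - f x * p x \<partial>lborel\<bar>" by simp
    also have "\<dots> \<le> 2 * R * (B * d)"
    proof (rule integral_abs_bounded_support)
      have [measurable]: "p \<in> borel_measurable borel" using cp by (rule borel_measurable_continuous_onI)
      show "(\<lambda>x. f x * f x - f x * p x) \<in> borel_measurable borel" by measurable
      show "\<bar>f x * f x - f x * p x\<bar> \<le> B * d" for x
      proof (cases "\<bar>x\<bar> > R")
        case False
        then have "\<bar>f x - p x\<bar> \<le> d" by (intro less_imp_le p(2)) auto
        then have "\<bar>f x\<bar> * \<bar>f x - p x\<bar> \<le> B * d" using B by (intro mult_mono) auto
        then show ?thesis by (simp flip: abs_mult right_diff_distrib)
      qed (use B d in \<open>simp add: supp\<close>)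
    qed (auto simp: supp R_nonneg)
    also have "\<dots> = 2 * R * B * d" by simp
    also have "\<dots> \<le> (2 * R * B + 1) * d" using d by (intro mult_right_mono) auto
    also have "\<dots> = e" using den by (simp add: d_def)
    finally show ?thesis .
  qed
  have "isCont f x" using cont by (simp add: continuous_on_eq_continuous_at)
  then obtain d where d: "d > 0" "\<And>y. \<bar>y - x\<bar> < d \<Longrightarrow> \<bar>f y - f x\<bar> < \<bar>f x\<bar> / 2"
    using nz unfolding continuous_at_eps_delta dist_real_def
    by (metis half_gt_zero_iff zero_less_abs_iff)
  \<comment> \<open>By continuity the square of \<open>f\<close> is at least \<open>c\<close> on an
    interval of length \<open>d\<close> around \<open>x\<close>. Its integral is then at least
    \<open>c * d\<close>, against the bound \<open>le\<close> with
    \<open>e = c * d / 2\<close>.\<close>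
  define c where "c = (\<bar>f x\<bar> / 2)\<^sup>2"
  have c: "c > 0" using nz by (simp add: c_def)
  have "c * d = (\<integral>y. c * indicator {x-d/2..x+d/2} y \<partial>lborel)" using d by simp
  also have "\<dots> \<le> (\<integral>y. f y * f y \<partial>lborel)"
  proof (rule integral_mono)
    show "integrable lborel (\<lambda>y. c * indicator {x-d/2..x+d/2} y :: real)"
      by (intro integrable_mult_right integrable_real_indicator) (auto simp: emeasure_lborel_Icc_eq)
    show "integrable lborel (\<lambda>y. f y * f y)" by (rule continuous_bump.integrable[OF sq])
    show "c * indicator {x-d/2..x+d/2} y \<le> f y * f y" for y
    proof (cases "y \<in> {x-d/2..x+d/2}")
      case True
      then have "\<bar>y - x\<bar> < d" using d(1) by (auto simp: abs_less_iff)
      then have "\<bar>f x\<bar> / 2 \<le> \<bar>f y\<bar>" using d(2)[of y] by linarith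
      then have "(\<bar>f x\<bar> / 2)\<^sup>2 \<le> \<bar>f y\<bar>\<^sup>2" by (intro power_mono) auto
      with True show ?thesis by (simp add: c_def power2_eq_square)
    qed simp
  qed
  finally show False using le[of "c * d / 2"] mult_pos_pos[OF c d(1)] by linarith
qed

end

text \<open>Among the translates with nonzero coefficient, the one with the smallest shift extends
  furthest to the right. Near its right edge all the others already vanish, so nothing can cancel
  it.\<close>

lemma translates_independent:
  fixes f :: "real \<Rightarrow> real" and b \<theta> :: "'i \<Rightarrow> real"
  assumes supp: "\<And>x. x > R \<Longrightarrow> f x = 0" and nz: "f y \<noteq> 0"
    and I: "finite I" "inj_on b I" and zero: "\<And>r. (\<Sum>i\<in>I. \<theta> i * f (r + b i)) = 0"
    and "i \<in> I"
  shows "\<theta> i = 0"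
proof (rule ccontr)
  assume "\<theta> i \<noteq> 0"
  define J where "J = {i\<in>I. \<theta> i \<noteq> 0}"
  have J: "finite J" "J \<noteq> {}" using I \<open>i \<in> I\<close> \<open>\<theta> i \<noteq> 0\<close> by (auto simp: J_def)
  obtain m where m: "m \<in> J" "\<And>i. i \<in> J \<Longrightarrow> b m \<le> b i"
    using ex_min_if_finite[of "b ` J"] J by (auto simp: not_less)
  have m_less: "b m < b i" if "i \<in> J - {m}" for i
    using m(2)[of i] that inj_onD[OF I(2), of m i] m(1) by (force simp: J_def)
  define S where "S = {x. f x \<noteq> 0}"
  have S: "S \<noteq> {}" "bdd_above S"
    using nz supp not_le by (auto simp: S_def intro!: bdd_aboveI[of _ R])
  \<comment> \<open>A gap between the smallest shift and all others. The supremum of the nonzero set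
    need not be attained, so a point within \<open>d\<close> of it is used.\<close>
  obtain d where d: "d > 0" "\<And>i. i \<in> J - {m} \<Longrightarrow> b m + d \<le> b i"
  proof (cases "J - {m} = {}")
    case True
    then show ?thesis by (intro that[of 1]) auto
  next
    case False
    have "Min (b ` (J - {m})) \<in> b ` (J - {m})" using J False by (intro Min_in) auto
    then show ?thesis using that[of "Min (b ` (J - {m})) - b m"] m_less J by auto
  qed
  obtain x where x: "x \<in> S" "Sup S - d < x"
    using less_cSupD[OF S(1), of "Sup S - d"] d(1) by auto
  have "\<theta> i * f (x - b m + b i) = 0" if "i \<in> I - {m}" for i
  proof (cases "i \<in> J")
    case True
    then have "x - b m + b i > Sup S" using d(2)[of i] that x(2) by auto
    then have "x - b m + b i \<notin> S" using cSup_upper[OF _ S(2)] by force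
    then show ?thesis by (simp add: S_def)
  qed (use that in \<open>auto simp: J_def\<close>)
  then have "(\<Sum>i\<in>I. \<theta> i * f (x - b m + b i)) = (\<Sum>i\<in>{m}. \<theta> i * f (x - b m + b i))"
    using I m(1) by (intro sum.mono_neutral_right) (auto simp: J_def)
  then show False using zero[of "x - b m"] m(1) x(1) by (auto simp: J_def S_def)
qed

text \<open>Only very negative \<open>j\<close> are used: they push the arguments out of the
  support, where the combination equals, up to the factor \<open>1 / pi\<close>, the Cauchy
  transform of the combined translates.\<close>

lemma (in lipschitz_bump) hilbert_combination_nonzero:
  fixes b \<theta> :: "'i \<Rightarrow> real"
  assumes nz: "g y \<noteq> 0" and I: "finite I" "inj_on b I" and i: "i \<in> I" "\<theta> i \<noteq> 0"
  shows "\<exists>j::int. (\<Sum>i\<in>I. \<theta> i * hilbert g (s - of_int j + b i)) \<noteq> 0"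
proof (rule ccontr)
  assume "\<not> ?thesis"
  then have zero: "(\<Sum>i\<in>I. \<theta> i * hilbert g (s - of_int j + b i)) = 0" for j :: int by blast
  define G where "G = (\<lambda>r. \<Sum>i\<in>I. \<theta> i * g (r + b i))"
  \<comment> \<open>Enlarging the radius by the sum of all shifts puts every translate, and hence
    \<open>G\<close>, inside one common interval.\<close>
  define R' where "R' = R + (\<Sum>i\<in>I. \<bar>b i\<bar>)"
  have b_le: "\<bar>b i\<bar> \<le> R' - R" if "i \<in> I" for i
    using member_le_sum[of i I "\<lambda>i. \<bar>b i\<bar>"] I that by (simp add: R'_def)
  have R': "R' \<ge> 0" using R_nonneg by (simp add: R'_def sum_nonneg)
  interpret G: continuous_bump G R'
  proof
    show "continuous_on UNIV G"
      unfolding G_def by (intro continuous_intros continuous_on_compose2[OF cont]) auto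
    show "G x = 0" if "\<bar>x\<bar> > R'" for x
      unfolding G_def
    proof (intro sum.neutral ballI)
      fix i assume "i \<in> I"
      then have "\<bar>x + b i\<bar> > R" using b_le[of i] that by linarith
      then show "\<theta> i * g (x + b i) = 0" by (simp add: supp)
    qed
  qed (rule R')
  have shift: "continuous_bump (\<lambda>r. g (r + b i)) R'" if "i \<in> I" for i
  proof
    show "continuous_on UNIV (\<lambda>r. g (r + b i))"
      by (intro continuous_intros continuous_on_compose2[OF cont]) auto
    show "g (x + b i) = 0" if "\<bar>x\<bar> > R'" for x
      using b_le[OF \<open>i \<in> I\<close>] that by (intro supp) linarith
  qed (rule R')
  \<comment> \<open>These are the points \<open>s - j\<close> lying beyond
    \<open>2 * R' + 1\<close>, the threshold of the Cauchy transform lemmas.\<close>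
  define X where "X n = s + of_int (\<lceil>2 * R' + 1 - s\<rceil> + int n)" for n
  have X_ge: "X n \<ge> 2 * R' + 1" for n unfolding X_def by linarith
  have X_lim: "filterlim X at_top sequentially"
  proof (rule filterlim_at_top_mono)
    show "filterlim (\<lambda>n. 2 * R' + 1 + real n) at_top sequentially"
      by (intro filterlim_tendsto_add_at_top[OF tendsto_const] filterlim_real_sequentially)
    show "eventually (\<lambda>n. 2 * R' + 1 + real n \<le> X n) sequentially"
      unfolding X_def by (intro always_eventually allI) linarith
  qed
  have "(\<integral>r. G r / (X n - r) \<partial>lborel) = 0" for n
  proof -
    have far: "hilbert g (X n + b i) = (1 / pi) * (\<integral>r. g (r + b i) / (X n - r) \<partial>lborel)" if "i \<in> I" for i
    proof -
      have "\<bar>X n + b i\<bar> > R" using X_ge[of n] b_le[OF that] R' R_nonneg by linarith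
      then have "hilbert g (X n + b i) = (1 / pi) * (\<integral>r. g r / (X n + b i - r) \<partial>lborel)"
        by (rule hilbert_far)
      also have "(\<integral>r. g r / (X n + b i - r) \<partial>lborel) =
          (\<integral>r. g (b i + 1 * r) / (X n + b i - (b i + 1 * r)) \<partial>lborel)"
        by (subst lborel_integral_real_affine[where c = 1 and t = "b i"]) auto
      finally show ?thesis by (simp add: add.commute)
    qed
    have "(\<integral>r. G r / (X n - r) \<partial>lborel) = (\<integral>r. (\<Sum>i\<in>I. \<theta> i * (g (r + b i) / (X n - r))) \<partial>lborel)"
      by (simp add: G_def sum_divide_distrib)
    also have "\<dots> = (\<Sum>i\<in>I. \<theta> i * (\<integral>r. g (r + b i) / (X n - r) \<partial>lborel))"
      by (subst Bochner_Integration.integral_sum)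
        (auto intro!: integrable_mult_right continuous_bump.integrable_cauchy[OF shift X_ge]
          simp del: times_divide_eq_right)
    also have "\<dots> = pi * (\<Sum>i\<in>I. \<theta> i * hilbert g (X n + b i))"
      by (simp add: far sum_distrib_left)
    also have "(\<Sum>i\<in>I. \<theta> i * hilbert g (X n + b i)) = 0"
    proof -
      have "X n = s - of_int (- (\<lceil>2 * R' + 1 - s\<rceil> + int n))"
        by (simp add: X_def)
      then show ?thesis using zero by (simp only:)
    qed
    finally show ?thesis by simp
  qed
  then have "G r = 0" for r
    by (intro G.zero_if_moments_zero G.moments_zero[OF X_lim X_ge])
  then show False
    using translates_independent[of R g y I b \<theta> i] supp nz I i by (simp add: G_def)
qed

section \<open>Kernel, lattice sums and directions\<close>

lemma deriv_zero_outside: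
  fixes f :: "real \<Rightarrow> real"
  assumes "\<And>x. \<bar>x\<bar> > R \<Longrightarrow> f x = 0" "\<bar>x\<bar> > R"
  shows "deriv f x = 0"
proof -
  have "open {y::real. \<bar>y\<bar> > R}" by (intro open_Collect_less continuous_intros)
  then have "eventually (\<lambda>y. y \<in> {y. \<bar>y\<bar> > R}) (nhds x)"
    using assms(2) by (intro eventually_nhds_in_open) auto
  then have "eventually (\<lambda>y. f y = 0) (nhds x)"
    by eventually_elim (use assms(1) in auto)
  then have "deriv f x = deriv (\<lambda>_. 0) x" by (intro deriv_cong_ev) auto
  then show ?thesis by simp
qed

text \<open>The second derivative is continuous with bounded support, hence bounded, which makes the
  first one Lipschitz. Its mean is zero by the fundamental theorem of calculus, and it cannot vanish
  identically, since a constant \<open>f\<close> with bounded support would be zero and could not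
  have integral 1.\<close>

lemma kernel_derivative:
  fixes f :: "real \<Rightarrow> real"
  assumes supp: "\<exists>R. \<forall>x. \<bar>x\<bar> > R \<longrightarrow> f x = 0"
    and diff: "\<forall>n<3. \<forall>x. (deriv ^^ n) f differentiable (at x)"
    and mass: "integral\<^sup>L lborel f = 1"
  obtains L R y where "lipschitz_bump (deriv f) L R" "integral\<^sup>L lborel (deriv f) = 0" "deriv f y \<noteq> 0"
proof -
  obtain R0 where R0: "\<And>x. \<bar>x\<bar> > R0 \<Longrightarrow> f x = 0" using supp by blast
  define R where "R = max R0 0"
  have R: "R \<ge> 0" and f0: "\<And>x. \<bar>x\<bar> > R \<Longrightarrow> f x = 0" using R0 by (auto simp: R_def)
  have f1: "\<bar>x\<bar> > R \<Longrightarrow> deriv f x = 0" for x using deriv_zero_outside[of R f] f0 by auto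
  have f2: "\<bar>x\<bar> > R \<Longrightarrow> deriv (deriv f) x = 0" for x
    using deriv_zero_outside[of R "deriv f"] f1 by auto
  have D0: "(f has_real_derivative deriv f x) (at x)" for x
    using diff[rule_format, of 0 x] by (simp add: DERIV_deriv_iff_real_differentiable)
  have D1: "(deriv f has_real_derivative deriv (deriv f) x) (at x)" for x
    using diff[rule_format, of 1 x] by (simp add: DERIV_deriv_iff_real_differentiable)
  have c1: "isCont (deriv f) x" for x using D1 by (rule DERIV_isCont)
  have c2: "isCont (deriv (deriv f)) x" for x
    using diff[rule_format, of 2 x]
    by (simp add: numeral_2_eq_2 differentiable_imp_continuous_within)
  interpret d2: continuous_bump "deriv (deriv f)" R
    by unfold_locales (use R f2 c2 in \<open>auto simp: continuous_on_eq_continuous_at\<close>)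
  obtain L where L: "\<And>x. \<bar>deriv (deriv f) x\<bar> \<le> L" using d2.bounded by blast
  have "\<bar>deriv f x - deriv f y\<bar> \<le> L * \<bar>x - y\<bar>" for x y
    using field_differentiable_bound[of UNIV "deriv f" "deriv (deriv f)" L x y] D1 L by auto
  then have bump: "lipschitz_bump (deriv f) L R" by unfold_locales (use R f1 in auto)
  have "(\<integral>x. deriv f x * indicator {-(R+1)..R+1} x \<partial>lborel) = f (R+1) - f (-(R+1))"
    by (rule integral_FTC_Icc_real) (use R D0 c1 in auto)
  also have "(\<lambda>x. deriv f x * indicator {-(R+1)..R+1} x) = deriv f"
  proof
    show "deriv f x * indicator {-(R+1)..R+1} x = deriv f x" for x
      using f1[of x] by (cases "\<bar>x\<bar> > R") (auto simp: indicator_def)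
  qed
  also have "f (R+1) - f (-(R+1)) = 0" using R f0[of "R+1"] f0[of "-(R+1)"] by simp
  finally have int0: "integral\<^sup>L lborel (deriv f) = 0" .
  have "\<exists>y. deriv f y \<noteq> 0"
  proof (rule ccontr)
    assume "\<not> ?thesis"
    then have "f x = f (R + 1)" for x
      using DERIV_isconst_all[of f x "R + 1"] D0 by metis
    then have "f = (\<lambda>_. 0)" using f0[of "R+1"] R by auto
    with mass show False by simp
  qed
  with bump int0 show ?thesis using that by blast
qed

section \<open>Lattice sums and the number of angles\<close>

lemma summable_on_int_inverse_square:
  "(\<lambda>m::int. 1 / (1 + (real_of_int m)\<^sup>2)) summable_on UNIV"
proof -
  have s: "summable (\<lambda>n::nat. 1 / (1 + (real n)\<^sup>2))"
  proof (rule summable_comparison_test_ev)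
    show "summable (\<lambda>n::nat. inverse ((real n)\<^sup>2))" by (rule inverse_power_summable) simp
    show "eventually (\<lambda>n. norm (1 / (1 + (real n)\<^sup>2)) \<le> inverse ((real n)\<^sup>2)) sequentially"
      using eventually_gt_at_top[of 0]
      by eventually_elim (auto simp: inverse_eq_divide intro!: divide_left_mono mult_pos_pos add_pos_nonneg)
  qed
  have s1: "(\<lambda>n. 1 / (1 + (real n)\<^sup>2)) summable_on A" for A
    using s by (intro summable_on_subset_banach[of _ UNIV A])
      (simp_all add: summable_on_UNIV_nonneg_real_iff)
  have pos: "(\<lambda>m::int. 1 / (1 + (real_of_int m)\<^sup>2)) summable_on int ` UNIV"
    by (subst summable_on_reindex) (use s1 in \<open>auto simp: o_def\<close>)
  have neg: "(\<lambda>m::int. 1 / (1 + (real_of_int m)\<^sup>2)) summable_on (\<lambda>n. - int n) ` {0<..}"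
    by (subst summable_on_reindex) (use s1 in \<open>auto simp: o_def inj_on_def\<close>)
  have "int ` UNIV \<union> (\<lambda>n. - int n) ` {0<..} = UNIV"
  proof (intro set_eqI iffI UNIV_I)
    fix m :: int
    show "m \<in> int ` UNIV \<union> (\<lambda>n. - int n) ` {0<..}"
      using image_eqI[of m int "nat m" UNIV] image_eqI[of m "\<lambda>n. - int n" "nat (- m)" "{0<..}"]
      by (cases "m \<ge> 0") auto
  qed
  moreover have "int ` UNIV \<inter> (\<lambda>n. - int n) ` {0<..} = {}" by auto
  ultimately show ?thesis using summable_on_Un_disjoint[OF pos neg] by simp
qed

text \<open>One constant \<open>W\<close> serves every offset \<open>a\<close>: replacing
  \<open>a\<close> by its integer part costs at most a factor 3, and the resulting sum over the
  integers is invariant under integer shifts.\<close>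

lemma shifted_inverse_square_sums:
  obtains W where "W \<ge> 0"
    "\<And>a A w. (\<And>j::int. 0 \<le> w j \<and> w j \<le> A / (1 + (a - real_of_int j)\<^sup>2)) \<Longrightarrow>
       w summable_on UNIV \<and> infsum w UNIV \<le> A * W"
proof
  let ?q = "\<lambda>m::int. 1 / (1 + (real_of_int m)\<^sup>2)"
  show "3 * infsum ?q UNIV \<ge> 0" by (intro mult_nonneg_nonneg infsum_nonneg) auto
  fix a A and w :: "int \<Rightarrow> real"
  assume w: "\<And>j::int. 0 \<le> w j \<and> w j \<le> A / (1 + (a - real_of_int j)\<^sup>2)"
  have "0 \<le> A / (1 + (a - real_of_int 0)\<^sup>2)" using w[of 0] by linarith
  moreover have "1 + (a - real_of_int 0)\<^sup>2 > 0" by (intro add_pos_nonneg) auto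
  ultimately have A: "A \<ge> 0" by (simp only: zero_le_divide_iff) linarith
  define v where "v = (\<lambda>j::int. 3 * A * ?q (j - \<lfloor>a\<rfloor>))"
  have le: "w j \<le> v j" for j
  proof -
    define x y where "x = a - real_of_int j" and "y = a - real_of_int \<lfloor>a\<rfloor>"
    have y: "0 \<le> y" "y \<le> 1" by (auto simp: y_def) linarith
    then have "y\<^sup>2 \<le> 1" by (simp add: power_le_one)
    \<comment> \<open>Here \<open>y - x\<close> is the integer
      \<open>j - \<lfloor>a\<rfloor>\<close>, and the fractional part \<open>y\<close> lies between
      0 and 1; together these give the factor 3.\<close>
    moreover have "(y - x)\<^sup>2 \<le> 2 * y\<^sup>2 + 2 * x\<^sup>2"
      using sum_squares_bound[of y "- x"] by (simp add: power2_diff)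
    ultimately have "1 + (y - x)\<^sup>2 \<le> 3 * (1 + x\<^sup>2)"
      using zero_le_power2[of x] unfolding distrib_left by linarith
    moreover have "1 / z \<le> 3 / u" if "u \<le> 3 * z" "u > 0" "z > 0" for u z :: real
      using that by (simp add: field_simps)
    ultimately have "1 / (1 + x\<^sup>2) \<le> 3 / (1 + (y - x)\<^sup>2)"
      by (simp add: add_pos_nonneg)
    then have "A * (1 / (1 + x\<^sup>2)) \<le> A * (3 / (1 + (y - x)\<^sup>2))" using A by (rule mult_left_mono)
    then show ?thesis using w[of j] by (simp add: v_def x_def y_def mult_ac)
  qed
  have bij: "bij_betw (\<lambda>j. j - \<lfloor>a\<rfloor>) UNIV (UNIV :: int set)"
    by (rule bij_betw_byWitness[where f' = "\<lambda>j. j + \<lfloor>a\<rfloor>"]) auto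
  have v: "v summable_on UNIV" unfolding v_def
    by (intro summable_on_cmult_right)
      (subst summable_on_reindex_bij_betw[OF bij, of ?q], rule summable_on_int_inverse_square)
  have sw: "w summable_on UNIV"
    by (rule summable_on_comparison_test[OF v]) (use le w in auto)
  have "infsum w UNIV \<le> infsum v UNIV" by (intro infsum_mono sw v le)
  also have "\<dots> = 3 * A * infsum (\<lambda>j. ?q (j - \<lfloor>a\<rfloor>)) UNIV"
    unfolding v_def by (rule infsum_cmult_right')
  also have "infsum (\<lambda>j. ?q (j - \<lfloor>a\<rfloor>)) UNIV = infsum ?q UNIV"
    by (rule infsum_reindex_bij_betw[OF bij])
  finally show "w summable_on UNIV \<and> infsum w UNIV \<le> A * (3 * infsum ?q UNIV)"
    using sw by (simp add: mult_ac)
qed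

lemma card_angles:
  assumes "e > 0"
  shows "finite {k. \<bar>real_of_int k * e\<bar> \<le> pi}"
    and "real (card {k. \<bar>real_of_int k * e\<bar> \<le> pi}) \<le> 2 * pi / e + 1"
proof -
  have eq: "{k. \<bar>real_of_int k * e\<bar> \<le> pi} = {-\<lfloor>pi / e\<rfloor>..\<lfloor>pi / e\<rfloor>}"
  proof (intro set_eqI)
    fix k :: int
    have "\<bar>real_of_int k * e\<bar> \<le> pi \<longleftrightarrow> real_of_int k \<le> pi / e \<and> real_of_int (- k) \<le> pi / e"
      using assms by (auto simp: abs_le_iff pos_le_divide_eq)
    also have "\<dots> \<longleftrightarrow> k \<le> \<lfloor>pi / e\<rfloor> \<and> - k \<le> \<lfloor>pi / e\<rfloor>"
      by (simp only: le_floor_iff)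
    finally show "k \<in> {k. \<bar>real_of_int k * e\<bar> \<le> pi} \<longleftrightarrow> k \<in> {-\<lfloor>pi / e\<rfloor>..\<lfloor>pi / e\<rfloor>}" by auto
  qed
  show "finite {k. \<bar>real_of_int k * e\<bar> \<le> pi}" unfolding eq by simp
  have "0 \<le> \<lfloor>pi / e\<rfloor>" using assms by simp
  then have "real (card {-\<lfloor>pi / e\<rfloor>..\<lfloor>pi / e\<rfloor>}) = 2 * real_of_int \<lfloor>pi / e\<rfloor> + 1" by simp
  also have "\<dots> \<le> 2 * (pi / e) + 1" using of_int_floor_le[of "pi / e"] by linarith
  finally show "real (card {k. \<bar>real_of_int k * e\<bar> \<le> pi}) \<le> 2 * pi / e + 1" unfolding eq by simp
qed

lemma card_window:
  fixes a b e :: real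
  assumes "e > 0"
  shows "real (card {\<lceil>a / e\<rceil>..\<lfloor>b / e\<rfloor>}) \<ge> (b - a) / e - 1"
proof -
  have "(b - a) / e - 1 \<le> real_of_int (\<lfloor>b / e\<rfloor> - \<lceil>a / e\<rceil> + 1)"
    unfolding diff_divide_distrib by linarith
  also have "\<dots> \<le> real (nat (\<lfloor>b / e\<rfloor> - \<lceil>a / e\<rceil> + 1))" by linarith
  finally show ?thesis by simp
qed

section \<open>Angles at which projections of distinct points coincide\<close>

lemma countable_dirvec_orthogonal:
  assumes "v \<noteq> 0"
  shows "countable {\<alpha>. dirvec \<alpha> \<bullet> v = 0}"
proof -
  obtain x y where v: "v = (x, y)" by (cases v)
  \<comment> \<open>Polar form of \<open>v\<close>: the inner product becomes a multiple of
    \<open>cos (\<alpha> - \<beta>)\<close>, whose zeros are a shifted copy of the multiples of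
    \<open>pi\<close>.\<close>
  obtain \<beta> where \<beta>: "x = norm v * cos \<beta>" "y = norm v * sin \<beta>"
  proof -
    have "(x / norm v)\<^sup>2 + (y / norm v)\<^sup>2 = 1"
      using assms by (simp add: v norm_Pair power_divide zero_prod_def sum_power2_eq_zero_iff flip: add_divide_distrib)
    then obtain \<beta> where "x / norm v = cos \<beta>" "y / norm v = sin \<beta>"
      using sincos_total_2pi by blast
    then show ?thesis using that[of \<beta>] assms by (simp add: field_simps)
  qed
  have eq: "dirvec \<alpha> \<bullet> v = norm v * cos (\<alpha> - \<beta>)" for \<alpha>
  proof -
    have "dirvec \<alpha> \<bullet> v = cos \<alpha> * x + sin \<alpha> * y" by (simp add: v dirvec_def)
    also have "\<dots> = norm v * cos (\<alpha> - \<beta>)"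
      by (simp only: \<beta> cos_diff) (simp add: algebra_simps)
    finally show ?thesis .
  qed
  have "{\<alpha>. dirvec \<alpha> \<bullet> v = 0} \<subseteq> range (\<lambda>i::int. \<beta> + (of_int i * pi + pi / 2))"
  proof (intro subsetI)
    fix \<alpha> assume "\<alpha> \<in> {\<alpha>. dirvec \<alpha> \<bullet> v = 0}"
    then have "cos (\<alpha> - \<beta>) = 0" using assms eq[of \<alpha>] by simp
    then obtain i :: int where "\<alpha> - \<beta> = of_int i * pi + pi / 2"
      unfolding cos_zero_iff_int2 by blast
    then show "\<alpha> \<in> range (\<lambda>i::int. \<beta> + (of_int i * pi + pi / 2))"
      by (intro image_eqI[of _ _ i]) auto
  qed
  then show ?thesis by (rule countable_subset) auto
qed

text \<open>A collision of the indices \<open>i\<close> and \<open>j\<close> means orthogonality to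
  the nonzero vector \<open>xc i - xc j\<close>, and there are finitely many pairs.\<close>

lemma countable_dirvec_collisions:
  assumes "finite I" "inj_on xc I"
  shows "countable {\<alpha>. \<not> inj_on (\<lambda>i. dirvec \<alpha> \<bullet> xc i) I}"
proof -
  have "{\<alpha>. \<not> inj_on (\<lambda>i. dirvec \<alpha> \<bullet> xc i) I} \<subseteq>
      (\<Union>(i, j) \<in> {(i, j) \<in> I \<times> I. i \<noteq> j}. {\<alpha>. dirvec \<alpha> \<bullet> (xc i - xc j) = 0})"
    by (force simp: inj_on_def inner_diff_right)
  moreover have "countable \<dots>"
  proof (intro countable_UN)
    show "countable {(i, j) \<in> I \<times> I. i \<noteq> j}"
      using assms(1) by (intro countable_finite) (rule finite_subset[of _ "I \<times> I"], auto)
    show "countable (case p of (i, j) \<Rightarrow> {\<alpha>. dirvec \<alpha> \<bullet> (xc i - xc j) = 0})"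
      if "p \<in> {(i, j) \<in> I \<times> I. i \<noteq> j}" for p
      using that assms(2) by (auto intro!: countable_dirvec_orthogonal dest: inj_onD)
  qed
  ultimately show ?thesis by (rule countable_subset)
qed

text \<open>The bound is uniform in the phase \<open>a\<close>, so nothing need be known about the
  distribution of the phases modulo 1. Integer shifts reduce \<open>a\<close> to its fractional
  part, which makes compactness available.\<close>

lemma integer_shifts_bounded_below:
  fixes G :: "real \<Rightarrow> real \<Rightarrow> real"
  assumes cont: "continuous_on UNIV (\<lambda>(\<alpha>, t). G \<alpha> t)"
    and nz: "\<And>s. \<exists>j::int. G \<alpha>0 (s - of_int j) \<noteq> 0"
  obtains \<delta> c J where "\<delta> > 0" "c > 0" "J \<ge> 0"
    "\<And>\<alpha> a. \<bar>\<alpha> - \<alpha>0\<bar> < \<delta> \<Longrightarrow> c \<le> (\<Sum>j\<in>{\<lfloor>a\<rfloor>-J..\<lfloor>a\<rfloor>+J}. (G \<alpha> (a - of_int j))\<^sup>2)"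
proof -
  define D where "D J \<alpha> s = (\<Sum>j\<in>{-int J..int J}. (G \<alpha> (s - of_int j))\<^sup>2)" for J \<alpha> s
  have D_cont: "continuous_on UNIV (\<lambda>(\<alpha>, s). D J \<alpha> s)" for J
    unfolding D_def case_prod_unfold
  proof (intro continuous_on_sum continuous_on_power)
    show "continuous_on UNIV (\<lambda>p. G (fst p) (snd p - of_int j))" for j :: int
      using continuous_on_compose2[OF cont, of UNIV "\<lambda>p. (fst p, snd p - of_int j)"]
      by (simp add: continuous_on_Pair continuous_on_fst continuous_on_snd continuous_on_diff)
  qed
  have D_cont2: "continuous_on UNIV (D J \<alpha>)" for J \<alpha>
  proof -
    have "continuous_on UNIV (\<lambda>s. (\<alpha>, s))" by (intro continuous_intros)
    from continuous_on_compose2[OF D_cont[of J] this] show ?thesis by simp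
  qed
  have D_mono: "D J \<alpha> s \<le> D J' \<alpha> s" if "J \<le> J'" for J J' \<alpha> s
    unfolding D_def by (rule sum_mono2) (use that in auto)
  have ex: "\<exists>J. D J \<alpha>0 s > 0" for s
  proof -
    obtain j :: int where j: "G \<alpha>0 (s - of_int j) \<noteq> 0" using nz by blast
    have "0 < (G \<alpha>0 (s - of_int j))\<^sup>2" using j by simp
    also have "\<dots> \<le> D (nat \<bar>j\<bar>) \<alpha>0 s"
      unfolding D_def by (rule member_le_sum) auto
    finally show ?thesis by blast
  qed
  obtain J where J: "\<And>s. s \<in> {0..1} \<Longrightarrow> D J \<alpha>0 s > 0"
  proof -
    have "open {s. D J \<alpha>0 s > 0}" for J
      by (intro open_Collect_less D_cont2 continuous_intros)
    moreover have "{0..1} \<subseteq> (\<Union>J. {s. D J \<alpha>0 s > 0})" using ex by blast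
    ultimately obtain C where C: "finite C" "{0..1} \<subseteq> (\<Union>J\<in>C. {s. D J \<alpha>0 s > 0})"
      by (rule compactE_image[OF compact_Icc, of UNIV]) auto
    show ?thesis
    \<comment> \<open>The sums increase with \<open>J\<close>, so the largest index of the finite
      subcover works everywhere; inserting 0 keeps \<open>Max\<close> defined for an empty
      subcover.\<close>
    proof (rule that[of "Max (insert 0 C)"])
      fix s :: real assume "s \<in> {0..1}"
      then obtain J where J: "J \<in> C" "D J \<alpha>0 s > 0" using C(2) by auto
      have "D J \<alpha>0 s \<le> D (Max (insert 0 C)) \<alpha>0 s" using C(1) J(1) by (intro D_mono Max_ge) auto
      with J(2) show "D (Max (insert 0 C)) \<alpha>0 s > 0" by linarith
    qed
  qed
  obtain s0 where s0: "s0 \<in> {0..1}" "\<And>s. s \<in> {0..1} \<Longrightarrow> D J \<alpha>0 s0 \<le> D J \<alpha>0 s"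
    using continuous_attains_inf[of "{0..1}" "D J \<alpha>0"] continuous_on_subset[OF D_cont2] by auto
  \<comment> \<open>Half of the minimum at \<open>\<alpha>0\<close>; the other half is given up when
    the angle moves away from \<open>\<alpha>0\<close>.\<close>
  define c where "c = D J \<alpha>0 s0 / 2"
  have c: "c > 0" using J s0(1) by (simp add: c_def)
  have "uniformly_continuous_on ({\<alpha>0-1..\<alpha>0+1} \<times> {0..1}) (\<lambda>(\<alpha>, s). D J \<alpha> s)"
    by (intro compact_uniformly_continuous continuous_on_subset[OF D_cont] compact_Times) auto
  then obtain d where d: "d > 0" "\<And>p q. p \<in> {\<alpha>0-1..\<alpha>0+1} \<times> {0..1} \<Longrightarrow> q \<in> {\<alpha>0-1..\<alpha>0+1} \<times> {0..1} \<Longrightarrow>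
      dist q p < d \<Longrightarrow> dist (case q of (\<alpha>, s) \<Rightarrow> D J \<alpha> s) (case p of (\<alpha>, s) \<Rightarrow> D J \<alpha> s) < c"
    using c unfolding uniformly_continuous_on_def by metis
  show ?thesis
  proof
    show "min d 1 > 0" "c > 0" "int J \<ge> 0" using d c by auto
    fix \<alpha> a :: real assume \<alpha>: "\<bar>\<alpha> - \<alpha>0\<bar> < min d 1"
    define s where "s = a - of_int \<lfloor>a\<rfloor>"
    have s: "s \<in> {0..1}" by (auto simp: s_def) linarith
    have "dist (\<alpha>, s) (\<alpha>0, s) < d" using \<alpha> by (simp add: dist_Pair_Pair dist_real_def)
    then have "dist (D J \<alpha> s) (D J \<alpha>0 s) < c"
      using d(2)[of "(\<alpha>0, s)" "(\<alpha>, s)"] s \<alpha> by (auto simp: abs_less_iff)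
    then have "c \<le> D J \<alpha> s" using s0(2)[OF s] unfolding dist_real_def c_def by linarith
    also have "D J \<alpha> s = (\<Sum>j\<in>{\<lfloor>a\<rfloor>-int J..\<lfloor>a\<rfloor>+int J}. (G \<alpha> (a - of_int j))\<^sup>2)"
      unfolding D_def
      by (rule sum.reindex_bij_witness[of _ "\<lambda>j. j - \<lfloor>a\<rfloor>" "\<lambda>j. j + \<lfloor>a\<rfloor>"])
        (auto simp: s_def algebra_simps)
    finally show "c \<le> \<dots>" .
  qed
qed

section \<open>Decay of shifted combinations and continuity of the noise level\<close>

lemma inverse_square_shift:
  fixes t b \<beta> :: real
  assumes "\<bar>b\<bar> \<le> \<beta>"
  shows "1 / (1 + (t + b)\<^sup>2) \<le> (2 + 2 * \<beta>\<^sup>2) / (1 + t\<^sup>2)"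
proof -
  have "b\<^sup>2 \<le> \<beta>\<^sup>2" using assms by (simp add: abs_le_square_iff[symmetric])
  moreover have "t\<^sup>2 \<le> 2 * (t + b)\<^sup>2 + 2 * b\<^sup>2"
  proof -
    have "2 * (t + b)\<^sup>2 + 2 * b\<^sup>2 - t\<^sup>2 = (t + 2 * b)\<^sup>2" by (simp add: power2_eq_square algebra_simps)
    then show ?thesis by (metis diff_ge_0_iff_ge zero_le_power2)
  qed
  ultimately have "1 + t\<^sup>2 \<le> (2 + 2 * \<beta>\<^sup>2) + 2 * (t + b)\<^sup>2" by linarith
  also have "\<dots> \<le> (2 + 2 * \<beta>\<^sup>2) * (1 + (t + b)\<^sup>2)"
    by (simp add: algebra_simps)
  finally show ?thesis
    by (simp add: pos_divide_le_eq pos_le_divide_eq add_pos_nonneg)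
qed

text \<open>The constant depends on the shifts only through the bound \<open>\<beta>\<close>. This
  gives uniformity over all angles, since projections of fixed points are bounded.\<close>

lemma combination_decay:
  fixes h \<theta> :: "_ \<Rightarrow> real"
  assumes h: "\<And>t. \<bar>h t\<bar> \<le> C / (1 + t\<^sup>2)" and "C \<ge> 0"
  obtains C' where "C' \<ge> 0"
    "\<And>b t. (\<And>i. i \<in> I \<Longrightarrow> \<bar>b i\<bar> \<le> \<beta>) \<Longrightarrow> \<bar>\<Sum>i\<in>I. \<theta> i * h (t + b i)\<bar> \<le> C' / (1 + t\<^sup>2)"
proof
  define C' where "C' = (\<Sum>i\<in>I. \<bar>\<theta> i\<bar>) * (C * (2 + 2 * \<beta>\<^sup>2))"
  show "C' \<ge> 0" using \<open>C \<ge> 0\<close> by (auto simp: C'_def intro!: mult_nonneg_nonneg sum_nonneg)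
  fix b t assume b: "\<And>i. i \<in> I \<Longrightarrow> \<bar>b i\<bar> \<le> \<beta>"
  have "\<bar>\<Sum>i\<in>I. \<theta> i * h (t + b i)\<bar> \<le> (\<Sum>i\<in>I. \<bar>\<theta> i\<bar> * \<bar>h (t + b i)\<bar>)"
    using sum_abs[of "\<lambda>i. \<theta> i * h (t + b i)" I] by (simp add: abs_mult)
  also have "\<dots> \<le> (\<Sum>i\<in>I. \<bar>\<theta> i\<bar> * (C * ((2 + 2 * \<beta>\<^sup>2) / (1 + t\<^sup>2))))"
  proof (intro sum_mono mult_left_mono)
    fix i assume "i \<in> I"
    have "\<bar>h (t + b i)\<bar> \<le> C * (1 / (1 + (t + b i)\<^sup>2))" using h[of "t + b i"] by simp
    also have "\<dots> \<le> C * ((2 + 2 * \<beta>\<^sup>2) / (1 + t\<^sup>2))"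
      using \<open>C \<ge> 0\<close> b[OF \<open>i \<in> I\<close>] by (intro mult_left_mono inverse_square_shift)
    finally show "\<bar>h (t + b i)\<bar> \<le> C * ((2 + 2 * \<beta>\<^sup>2) / (1 + t\<^sup>2))" .
  qed simp
  also have "\<dots> = C' / (1 + t\<^sup>2)" by (simp add: C'_def sum_distrib_right sum_divide_distrib)
  finally show "\<bar>\<Sum>i\<in>I. \<theta> i * h (t + b i)\<bar> \<le> C' / (1 + t\<^sup>2)" .
qed

text \<open>All but one of the \<open>n\<close> decay factors are discarded, as each is at most 1;
  the one kept suffices for summation over the lattice. It serves third moments and variances
  alike.\<close>

lemma power_decay:
  fixes x C t m M :: real
  assumes x: "\<bar>x\<bar> \<le> C / (1 + t\<^sup>2)" and "n \<ge> 1" and m: "0 \<le> m" "m \<le> M"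
  shows "\<bar>x\<bar> ^ n * m \<le> C ^ n * M / (1 + t\<^sup>2)"
proof -
  have q: "1 + t\<^sup>2 \<ge> 1" by simp
  then have q0: "1 + t\<^sup>2 > 0" by linarith
  have "0 \<le> C / (1 + t\<^sup>2)" using x by (meson abs_ge_zero order_trans)
  then have C: "C \<ge> 0" using q by (simp only: zero_le_divide_iff) linarith
  have "\<bar>x\<bar> ^ n \<le> (C / (1 + t\<^sup>2)) ^ n" using x by (intro power_mono) auto
  also have "\<dots> = C ^ n / (1 + t\<^sup>2) ^ n" by (rule power_divide)
  also have "\<dots> \<le> C ^ n / (1 + t\<^sup>2)"
    using C q0 power_increasing[OF \<open>n \<ge> 1\<close> q] by (intro divide_left_mono mult_pos_pos zero_less_power) auto
  finally have "\<bar>x\<bar> ^ n * m \<le> C ^ n / (1 + t\<^sup>2) * M"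
    using m C q by (intro mult_mono) auto
  then show ?thesis by simp
qed

text \<open>The mean value bound is applied along two axis-parallel segments, whence the Lipschitz
  constant \<open>2 * B\<close>.\<close>

lemma jointly_continuous_if_bounded_partials:
  fixes \<sigma> \<sigma>a \<sigma>p :: "real \<Rightarrow> real \<Rightarrow> real"
  assumes Da: "\<And>a p. ((\<lambda>x. \<sigma> x p) has_real_derivative \<sigma>a a p) (at a)"
    and Dp: "\<And>a p. ((\<lambda>y. \<sigma> a y) has_real_derivative \<sigma>p a p) (at p)"
    and B: "\<And>a p. \<bar>\<sigma>a a p\<bar> \<le> B" "\<And>a p. \<bar>\<sigma>p a p\<bar> \<le> B"
  shows "continuous_on UNIV (\<lambda>(a, p). \<sigma> a p)"
proof (rule lipschitz_on_continuous_on)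
  have B0: "B \<ge> 0" using B(1)[of 0 0] by linarith
  show "(2 * B)-lipschitz_on UNIV (\<lambda>(a, p). \<sigma> a p)"
  proof (rule lipschitz_onI)
    show "0 \<le> 2 * B" using B0 by simp
    fix u v :: "real \<times> real"
    obtain a p where u: "u = (a, p)" by (cases u)
    obtain a' p' where v: "v = (a', p')" by (cases v)
    have "\<bar>\<sigma> a p - \<sigma> a' p\<bar> \<le> B * \<bar>a - a'\<bar>"
      using field_differentiable_bound[of UNIV "\<lambda>x. \<sigma> x p" "\<lambda>x. \<sigma>a x p" B a a'] Da B(1) by auto
    moreover have "\<bar>\<sigma> a' p - \<sigma> a' p'\<bar> \<le> B * \<bar>p - p'\<bar>"
      using field_differentiable_bound[of UNIV "\<sigma> a'" "\<sigma>p a'" B p p'] Dp B(2) by auto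
    moreover have "B * \<bar>a - a'\<bar> \<le> B * dist u v" "B * \<bar>p - p'\<bar> \<le> B * dist u v"
      using B0 dist_fst_le[of u v] dist_snd_le[of u v]
      by (auto intro!: mult_left_mono simp: u v dist_real_def)
    ultimately show "dist (case u of (a, p) \<Rightarrow> \<sigma> a p) (case v of (a, p) \<Rightarrow> \<sigma> a p) \<le> 2 * B * dist u v"
      unfolding u v dist_real_def prod.case by linarith
  qed
qed

lemma continuous_on_dirvec [continuous_intros]:
  fixes f :: "'a::t2_space \<Rightarrow> real"
  shows "continuous_on S f \<Longrightarrow> continuous_on S (\<lambda>x. dirvec (f x))"
  unfolding dirvec_def by (intro continuous_on_Pair continuous_on_cos continuous_on_sin)

lemma abs_dirvec_inner_le: "\<bar>dirvec \<alpha> \<bullet> v\<bar> \<le> norm v"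
  using Cauchy_Schwarz_ineq2[of "dirvec \<alpha>" v] by (simp add: dirvec_def norm_Pair)

lemma dirvec_periodic: "dirvec (\<alpha> - 2 * pi) = dirvec \<alpha>"
  by (simp add: dirvec_def cos_diff sin_diff)

section \<open>Summation over the angles\<close>

lemma sum_infsum_upper_bound:
  fixes w :: "int \<Rightarrow> int \<Rightarrow> real"
  assumes e: "0 < e" "e \<le> 1" and A: "A \<ge> 0"
    and w: "\<And>k. \<bar>real_of_int k * e\<bar> \<le> pi \<Longrightarrow> infsum (w k) UNIV \<le> A * e powr (3/2)"
  shows "(\<Sum>k\<in>{k. \<bar>real_of_int k * e\<bar> \<le> pi}. infsum (w k) UNIV) \<le> (2 * pi + 1) * A * sqrt e"
proof -
  have "(\<Sum>k\<in>{k. \<bar>real_of_int k * e\<bar> \<le> pi}. infsum (w k) UNIV) \<le>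
      real (card {k. \<bar>real_of_int k * e\<bar> \<le> pi}) * (A * e powr (3/2))"
    using w by (intro sum_bounded_above) auto
  also have "\<dots> \<le> ((2 * pi + 1) / e) * (A * e powr (3/2))"
  proof (rule mult_right_mono)
    have "real (card {k. \<bar>real_of_int k * e\<bar> \<le> pi}) \<le> 2 * pi / e + 1"
      by (rule card_angles(2)[OF e(1)])
    \<comment> \<open>The condition \<open>e \<le> 1\<close> absorbs the additive 1 of the count.
      The order \<open>1 / e\<close> of the number of angles against \<open>e powr (3/2)\<close>
      leaves \<open>sqrt e\<close>.\<close>
    also have "\<dots> \<le> 2 * pi / e + 1 / e" using e by simp
    finally show "real (card {k. \<bar>real_of_int k * e\<bar> \<le> pi}) \<le> (2 * pi + 1) / e"
      by (simp add: add_divide_distrib)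
  qed (use A in simp)
  also have "e powr (3/2) = e * sqrt e"
    using e powr_add[of e 1 "1/2"] by (simp add: powr_half_sqrt)
  also have "(2 * pi + 1) / e * (A * (e * sqrt e)) = (2 * pi + 1) * A * sqrt e"
    using e by simp
  finally show ?thesis .
qed

text \<open>A fixed window of angles holds a number of grid angles proportional to
  \<open>1 / e\<close>, each contributing at least \<open>A * e\<close>; the remaining terms are
  nonnegative.\<close>

lemma sum_infsum_lower_bound:
  fixes w :: "int \<Rightarrow> int \<Rightarrow> real"
  assumes e: "e > 0" "e \<le> \<delta>" and window: "-pi \<le> \<tau> - \<delta>" "\<tau> + \<delta> \<le> pi" and A: "A \<ge> 0"
    and nonneg: "\<And>k j. \<bar>real_of_int k * e\<bar> \<le> pi \<Longrightarrow> w k j \<ge> 0"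
    and w: "\<And>k. \<bar>real_of_int k * e - \<tau>\<bar> \<le> \<delta> \<Longrightarrow> A * e \<le> infsum (w k) UNIV"
  shows "A * \<delta> \<le> (\<Sum>k\<in>{k. \<bar>real_of_int k * e\<bar> \<le> pi}. infsum (w k) UNIV)"
proof -
  define S where "S = {\<lceil>(\<tau> - \<delta>) / e\<rceil>..\<lfloor>(\<tau> + \<delta>) / e\<rfloor>}"
  have S: "\<tau> - \<delta> \<le> real_of_int k * e" "real_of_int k * e \<le> \<tau> + \<delta>" if "k \<in> S" for k
    using that e by (auto simp: S_def ceiling_le_iff le_floor_iff pos_divide_le_eq pos_le_divide_eq)
  \<comment> \<open>As \<open>e \<le> \<delta>\<close>, the 1 lost in counting is at most
    \<open>\<delta> / e\<close>.\<close>
  have "\<delta> / e \<le> 2 * \<delta> / e - 1" using e by (simp add: field_simps)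
  also have "2 * \<delta> / e - 1 \<le> real (card S)"
    unfolding S_def using card_window[OF e(1), of "\<tau> + \<delta>" "\<tau> - \<delta>"] by simp
  finally have card: "\<delta> / e \<le> real (card S)" .
  have "A * \<delta> = (\<delta> / e) * (A * e)" using e by simp
  also have "\<dots> \<le> real (card S) * (A * e)" using card A e by (intro mult_right_mono) auto
  also have "\<dots> \<le> (\<Sum>k\<in>S. infsum (w k) UNIV)"
    using S by (intro sum_bounded_below w) (force simp: abs_le_iff)
  also have "\<dots> \<le> (\<Sum>k\<in>{k. \<bar>real_of_int k * e\<bar> \<le> pi}. infsum (w k) UNIV)"
    using S window e card_angles(1)[OF e(1)]
    by (intro sum_mono2 infsum_nonneg nonneg) (force simp: abs_le_iff)+
  finally show ?thesis .
qed

section \<open>The Lyapunov ratio\<close>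

theorem theorem2:
  fixes \<kappa> pbar :: real
    and \<sigma> :: "real \<Rightarrow> real \<Rightarrow> real"
    and \<phi> :: "real \<Rightarrow> real"
    and Mo :: nat and \<nu> :: real
    and x0 :: "real \<times> real"
    and K :: nat and xc :: "nat \<Rightarrow> real \<times> real" and \<theta> :: "nat \<Rightarrow> real"
    and P :: "real \<Rightarrow> 'w measure"
    and \<eta> :: "real \<Rightarrow> int \<Rightarrow> int \<Rightarrow> 'w \<Rightarrow> real"
  assumes kappa_pos: "\<kappa> > 0"
    and K_pos: "K \<ge> 1"
    and xc_distinct: "inj_on xc {1..K}"
    and theta_nz: "\<exists>i\<in>{1..K}. \<theta> i \<noteq> 0"
    \<comment> \<open>sigma: 2 pi periodic in alpha, C^1, bounded with bounded first partials\<close>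
    and sigma_periodic: "\<And>a p. \<sigma> (a + 2 * pi) p = \<sigma> a p"
    and sigma_C1: "\<exists>\<sigma>a \<sigma>p.
          (\<forall>a p. ((\<lambda>x. \<sigma> x p) has_real_derivative \<sigma>a a p) (at a)
               \<and> ((\<lambda>y. \<sigma> a y) has_real_derivative \<sigma>p a p) (at p))
        \<and> continuous_on UNIV (\<lambda>(a, p). \<sigma>a a p) \<and> continuous_on UNIV (\<lambda>(a, p). \<sigma>p a p)
        \<and> (\<exists>B. \<forall>a p. \<bar>\<sigma> a p\<bar> \<le> B \<and> \<bar>\<sigma>a a p\<bar> \<le> B \<and> \<bar>\<sigma>p a p\<bar> \<le> B)"
    \<comment> \<open>noise (N1)-(N3), for every epsilon > 0\<close>
    and prob: "\<And>\<epsilon>. \<epsilon> > 0 \<Longrightarrow> prob_space (P \<epsilon>)"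
    and rv: "\<And>\<epsilon> k j. \<epsilon> > 0 \<Longrightarrow> \<eta> \<epsilon> k j \<in> borel_measurable (P \<epsilon>)"
    and indep: "\<And>\<epsilon>. \<epsilon> > 0 \<Longrightarrow>
        prob_space.indep_vars (P \<epsilon>) (\<lambda>_. borel) (\<lambda>(k, j). \<eta> \<epsilon> k j)
          ({k. \<bar>real_of_int k * (\<kappa> * \<epsilon>)\<bar> \<le> pi} \<times> UNIV)"
    and N1: "\<And>\<epsilon> k j. \<epsilon> > 0 \<Longrightarrow> \<bar>real_of_int k * (\<kappa> * \<epsilon>)\<bar> \<le> pi \<Longrightarrow>
        integrable (P \<epsilon>) (\<eta> \<epsilon> k j) \<and> (\<integral>\<omega>. \<eta> \<epsilon> k j \<omega> \<partial>P \<epsilon>) = 0"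
    and N2: "\<And>\<epsilon> k j. \<epsilon> > 0 \<Longrightarrow> \<bar>real_of_int k * (\<kappa> * \<epsilon>)\<bar> \<le> pi \<Longrightarrow>
        integrable (P \<epsilon>) (\<lambda>\<omega>. (\<eta> \<epsilon> k j \<omega>)\<^sup>2) \<and>
        (\<integral>\<omega>. (\<eta> \<epsilon> k j \<omega>)\<^sup>2 \<partial>P \<epsilon>)
          = (\<sigma> (real_of_int k * (\<kappa> * \<epsilon>)) (pbar + real_of_int j * \<epsilon>))\<^sup>2 * (\<kappa> * \<epsilon>)"
    and N3: "\<exists>c. \<forall>\<epsilon> k j. \<epsilon> > 0 \<longrightarrow> \<bar>real_of_int k * (\<kappa> * \<epsilon>)\<bar> \<le> pi \<longrightarrow>
        integrable (P \<epsilon>) (\<lambda>\<omega>. \<bar>\<eta> \<epsilon> k j \<omega>\<bar> ^ 3) \<and>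
        (\<integral>\<omega>. \<bar>\<eta> \<epsilon> k j \<omega>\<bar> ^ 3 \<partial>P \<epsilon>) \<le> c * (\<kappa> * \<epsilon>) powr (3 / 2)"
    \<comment> \<open>kernel (K1)-(K3)\<close>
    and K1: "\<exists>R. \<forall>x. \<bar>x\<bar> > R \<longrightarrow> \<phi> x = 0"
    and K2: "Mo \<ge> 3"
    and K2_diff: "\<forall>n<Mo. \<forall>x. (deriv ^^ n) \<phi> differentiable (at x)"
    and K2_lip: "\<exists>L. \<forall>x y. \<bar>(deriv ^^ Mo) \<phi> x - (deriv ^^ Mo) \<phi> y\<bar> \<le> L * \<bar>x - y\<bar>"
    and K3: "integral\<^sup>L lborel \<phi> = 1"
    and M_nu: "real Mo > \<nu> + 1"
    \<comment> \<open>(X1), (X2)\<close>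
    and nu_pos: "\<nu> > 0"
    and X1: "irrational_of_type (\<kappa> * norm x0) \<nu>"
    and X2: "\<exists>\<Omega>. open \<Omega> \<and> \<Omega> \<noteq> {} \<and> \<Omega> \<subseteq> {0..2 * pi} \<and>
               (\<forall>\<alpha>\<in>\<Omega>. (\<sigma> \<alpha> (dirvec \<alpha> \<bullet> x0))\<^sup>2 \<noteq> 0)"
  shows "(\<lambda>\<epsilon>.
      (\<Sum>k\<in>{k. \<bar>real_of_int k * (\<kappa> * \<epsilon>)\<bar> \<le> pi}. \<Sum>\<^sub>\<infinity>j\<in>(UNIV :: int set).
         \<bar>\<Sum>i=1..K. \<theta> i * hilbert (deriv \<phi>)
             ((dirvec (real_of_int k * (\<kappa> * \<epsilon>)) \<bullet> x0 - pbar) / \<epsilon> - real_of_int j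
               + dirvec (real_of_int k * (\<kappa> * \<epsilon>)) \<bullet> xc i)\<bar> ^ 3
         * (\<integral>\<omega>. \<bar>\<eta> \<epsilon> k j \<omega>\<bar> ^ 3 \<partial>P \<epsilon>))
      / ((\<Sum>k\<in>{k. \<bar>real_of_int k * (\<kappa> * \<epsilon>)\<bar> \<le> pi}. \<Sum>\<^sub>\<infinity>j\<in>(UNIV :: int set).
         (\<Sum>i=1..K. \<theta> i * hilbert (deriv \<phi>)
             ((dirvec (real_of_int k * (\<kappa> * \<epsilon>)) \<bullet> x0 - pbar) / \<epsilon> - real_of_int j
               + dirvec (real_of_int k * (\<kappa> * \<epsilon>)) \<bullet> xc i))\<^sup>2
         * (\<integral>\<omega>. (\<eta> \<epsilon> k j \<omega>)\<^sup>2 \<partial>P \<epsilon>)) powr (3 / 2)))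
    \<in> O[at_right 0](\<lambda>\<epsilon>. sqrt \<epsilon>)"
proof -
  define h where "h = hilbert (deriv \<phi>)"
  define G where "G \<alpha> t = (\<Sum>i=1..K. \<theta> i * h (t + dirvec \<alpha> \<bullet> xc i))" for \<alpha> t
  obtain L R y where bump: "lipschitz_bump (deriv \<phi>) L R"
    and int0: "integral\<^sup>L lborel (deriv \<phi>) = 0" and y: "deriv \<phi> y \<noteq> 0"
  proof -
    have "\<forall>n<3. \<forall>x. (deriv ^^ n) \<phi> differentiable (at x)" using K2 K2_diff by auto
    from kernel_derivative[OF K1 this K3] show thesis using that by blast
  qed
  interpret lipschitz_bump "deriv \<phi>" L R by (rule bump)
  obtain C0 where C0: "C0 > 0" "\<And>t. \<bar>h t\<bar> \<le> C0 / (1 + t\<^sup>2)"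
    using hilbert_decay[OF int0] unfolding h_def by blast
  define \<beta> where "\<beta> = (\<Sum>i=1..K. norm (xc i))"
  have \<beta>: "\<bar>dirvec \<alpha> \<bullet> xc i\<bar> \<le> \<beta>" if "i \<in> {1..K}" for \<alpha> i
  proof -
    have "norm (xc i) \<le> \<beta>" unfolding \<beta>_def by (rule member_le_sum) (use that in auto)
    then show ?thesis using abs_dirvec_inner_le[of \<alpha> "xc i"] by linarith
  qed
  obtain C where C: "C \<ge> 0" and G_decay: "\<And>\<alpha> t. \<bar>G \<alpha> t\<bar> \<le> C / (1 + t\<^sup>2)"
  proof -
    obtain C where C: "C \<ge> 0" "\<And>b t. (\<And>i. i \<in> {1..K} \<Longrightarrow> \<bar>b i\<bar> \<le> \<beta>) \<Longrightarrow>
        \<bar>\<Sum>i=1..K. \<theta> i * h (t + b i)\<bar> \<le> C / (1 + t\<^sup>2)"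
      using combination_decay[OF C0(2) less_imp_le[OF C0(1)]] by metis
    have "\<bar>G \<alpha> t\<bar> \<le> C / (1 + t\<^sup>2)" for \<alpha> t unfolding G_def by (intro C(2) \<beta>)
    then show thesis using that C(1) by blast
  qed
  have G_cont: "continuous_on UNIV (\<lambda>(\<alpha>, t). G \<alpha> t)"
    unfolding G_def h_def case_prod_unfold
    by (intro continuous_intros continuous_on_compose2[OF continuous_hilbert]) auto
  obtain \<sigma>a \<sigma>p B where
    Da: "\<And>a p. ((\<lambda>x. \<sigma> x p) has_real_derivative \<sigma>a a p) (at a)" and
    Dp: "\<And>a p. ((\<lambda>y. \<sigma> a y) has_real_derivative \<sigma>p a p) (at p)" and
    B: "\<And>a p. \<bar>\<sigma> a p\<bar> \<le> B" "\<And>a p. \<bar>\<sigma>a a p\<bar> \<le> B" "\<And>a p. \<bar>\<sigma>p a p\<bar> \<le> B"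
    using sigma_C1 by metis
  have \<sigma>_cont: "continuous_on UNIV (\<lambda>(a, p). \<sigma> a p)"
    using Da Dp B(2,3) by (rule jointly_continuous_if_bounded_partials)
  obtain \<alpha>0 where \<alpha>0: "\<bar>\<alpha>0\<bar> < pi" "\<sigma> \<alpha>0 (dirvec \<alpha>0 \<bullet> x0) \<noteq> 0"
    "inj_on (\<lambda>i. dirvec \<alpha>0 \<bullet> xc i) {1..K}"
  proof -
    obtain \<Omega> where \<Omega>: "open \<Omega>" "\<Omega> \<noteq> {}" "\<Omega> \<subseteq> {0..2 * pi}"
      "\<And>\<alpha>. \<alpha> \<in> \<Omega> \<Longrightarrow> \<sigma> \<alpha> (dirvec \<alpha> \<bullet> x0) \<noteq> 0" using X2 by auto
    \<comment> \<open>The angle \<open>pi\<close> is removed as well, so that the chosen angle is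
      interior to the summation range after reduction modulo \<open>2 * pi\<close>.\<close>
    have "countable ({\<alpha>. \<not> inj_on (\<lambda>i. dirvec \<alpha> \<bullet> xc i) {1..K}} \<union> {pi})"
      using countable_dirvec_collisions[OF _ xc_distinct] by simp
    from open_minus_countable[OF this \<Omega>(2,1)]
    obtain \<alpha> where \<alpha>: "\<alpha> \<in> \<Omega>" "inj_on (\<lambda>i. dirvec \<alpha> \<bullet> xc i) {1..K}" "\<alpha> \<noteq> pi"
      by auto
    show thesis
    proof (cases "\<alpha> < pi")
      case True
      then show ?thesis using that[of \<alpha>] \<alpha> \<Omega>(3,4) by auto
    next
      case False
      have "\<sigma> (\<alpha> - 2 * pi) p = \<sigma> \<alpha> p" for p using sigma_periodic[of "\<alpha> - 2 * pi" p] by simp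
      then show ?thesis using that[of "\<alpha> - 2 * pi"] \<alpha> \<Omega>(3,4) False
        by (force simp: dirvec_periodic)
    qed
  qed
  have "\<exists>j::int. G \<alpha>0 (s - of_int j) \<noteq> 0" for s
    using hilbert_combination_nonzero[OF y _ \<alpha>0(3)] theta_nz unfolding G_def h_def by blast
  then obtain \<delta>1 c J where \<delta>1: "\<delta>1 > 0" and c: "c > 0" and J: "J \<ge> 0" and
    G_low: "\<And>\<alpha> a. \<bar>\<alpha> - \<alpha>0\<bar> < \<delta>1 \<Longrightarrow> c \<le> (\<Sum>j\<in>{\<lfloor>a\<rfloor>-J..\<lfloor>a\<rfloor>+J}. (G \<alpha> (a - of_int j))\<^sup>2)"
    using integer_shifts_bounded_below[OF G_cont] by metis
  define m where "m = \<bar>\<sigma> \<alpha>0 (dirvec \<alpha>0 \<bullet> x0)\<bar> / 2"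
  have m: "m > 0" using \<alpha>0(2) by (simp add: m_def)
  obtain \<delta>2 where \<delta>2: "\<delta>2 > 0"
    "\<And>\<alpha> p. \<bar>\<alpha> - \<alpha>0\<bar> < \<delta>2 \<Longrightarrow> \<bar>p - dirvec \<alpha> \<bullet> x0\<bar> < \<delta>2 \<Longrightarrow> m \<le> \<bar>\<sigma> \<alpha> p\<bar>"
  proof -
    \<comment> \<open>Measuring \<open>p\<close> by its offset from
      \<open>dirvec \<alpha> \<bullet> x0\<close> gives a neighbourhood that follows the curve as
      the angle moves, as is required for the relevant lattice points.\<close>
    have "continuous_on UNIV (\<lambda>q. (fst q, dirvec (fst q) \<bullet> x0 + snd q))" by (intro continuous_intros)
    from continuous_on_compose2[OF \<sigma>_cont this]
    have "isCont (\<lambda>q. \<sigma> (fst q) (dirvec (fst q) \<bullet> x0 + snd q)) (\<alpha>0, 0)"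
      by (simp add: continuous_on_eq_continuous_at)
    then obtain d where d: "d > 0" "\<And>q. dist q (\<alpha>0, 0) < d \<Longrightarrow>
        \<bar>\<sigma> (fst q) (dirvec (fst q) \<bullet> x0 + snd q) - \<sigma> \<alpha>0 (dirvec \<alpha>0 \<bullet> x0)\<bar> < m"
      using m unfolding continuous_at_eps_delta dist_real_def by fastforce
    show thesis
    proof (rule that[of "d / 2"])
      fix \<alpha> p assume "\<bar>\<alpha> - \<alpha>0\<bar> < d / 2" "\<bar>p - dirvec \<alpha> \<bullet> x0\<bar> < d / 2"
      then have "dist (\<alpha>, p - dirvec \<alpha> \<bullet> x0) (\<alpha>0, 0) < d"
        using sqrt_sum_squares_le_sum_abs[of "\<alpha> - \<alpha>0" "p - dirvec \<alpha> \<bullet> x0"]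
        by (simp add: dist_Pair_Pair dist_real_def)
      from d(2)[OF this] have "\<bar>\<sigma> \<alpha>0 (dirvec \<alpha>0 \<bullet> x0) - \<sigma> \<alpha> p\<bar> < m"
        by (simp add: abs_minus_commute)
      then show "m \<le> \<bar>\<sigma> \<alpha> p\<bar>"
        using abs_triangle_ineq2[of "\<sigma> \<alpha>0 (dirvec \<alpha>0 \<bullet> x0)" "\<sigma> \<alpha> p"] unfolding m_def by simp
    qed (use d in simp)
  qed
  \<comment> \<open>The halves give strict inequalities on the closed window, and the last term
    keeps the window inside the range from \<open>-pi\<close> to \<open>pi\<close>.\<close>
  define \<delta> where "\<delta> = min (min (\<delta>1 / 2) (\<delta>2 / 2)) (pi - \<bar>\<alpha>0\<bar>)"
  have \<delta>: "\<delta> > 0" "\<delta> < \<delta>1" "\<delta> < \<delta>2" "-pi \<le> \<alpha>0 - \<delta>" "\<alpha>0 + \<delta> \<le> pi"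
    using \<delta>1 \<delta>2(1) \<alpha>0(1) by (auto simp: \<delta>_def min_def abs_if split: if_splits)
  obtain c3 where N3: "\<And>\<epsilon> k j. \<epsilon> > 0 \<Longrightarrow> \<bar>real_of_int k * (\<kappa> * \<epsilon>)\<bar> \<le> pi \<Longrightarrow>
        (\<integral>\<omega>. \<bar>\<eta> \<epsilon> k j \<omega>\<bar> ^ 3 \<partial>P \<epsilon>) \<le> c3 * (\<kappa> * \<epsilon>) powr (3 / 2)"
    using N3 by blast
  obtain W where W: "W \<ge> 0" "\<And>a A w. (\<And>j::int. 0 \<le> w j \<and> w j \<le> A / (1 + (a - real_of_int j)\<^sup>2)) \<Longrightarrow>
       w summable_on UNIV \<and> infsum w UNIV \<le> A * W"
    using shifted_inverse_square_sums by metis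
  \<comment> \<open>The absolute value of \<open>c3\<close> is taken because (N3) does not prescribe
    the sign of its constant.\<close>
  define E where "E = C ^ 3 * \<bar>c3\<bar> * W"
  have E: "E \<ge> 0" using C W(1) by (simp add: E_def)
  define num den where
    "num \<epsilon> = (\<Sum>k\<in>{k. \<bar>real_of_int k * (\<kappa> * \<epsilon>)\<bar> \<le> pi}. \<Sum>\<^sub>\<infinity>j.
         \<bar>G (real_of_int k * (\<kappa> * \<epsilon>))
           ((dirvec (real_of_int k * (\<kappa> * \<epsilon>)) \<bullet> x0 - pbar) / \<epsilon> - real_of_int j)\<bar> ^ 3
         * (\<integral>\<omega>. \<bar>\<eta> \<epsilon> k j \<omega>\<bar> ^ 3 \<partial>P \<epsilon>))" and
    "den \<epsilon> = (\<Sum>k\<in>{k. \<bar>real_of_int k * (\<kappa> * \<epsilon>)\<bar> \<le> pi}. \<Sum>\<^sub>\<infinity>j.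
         (G (real_of_int k * (\<kappa> * \<epsilon>))
           ((dirvec (real_of_int k * (\<kappa> * \<epsilon>)) \<bullet> x0 - pbar) / \<epsilon> - real_of_int j))\<^sup>2
         * (\<integral>\<omega>. (\<eta> \<epsilon> k j \<omega>)\<^sup>2 \<partial>P \<epsilon>))" for \<epsilon>
  have num_nonneg: "0 \<le> num \<epsilon>" for \<epsilon>
    unfolding num_def by (intro sum_nonneg infsum_nonneg mult_nonneg_nonneg) auto
  have num_le: "num \<epsilon> \<le> (2 * pi + 1) * E * sqrt (\<kappa> * \<epsilon>)" if \<epsilon>: "\<epsilon> > 0" "\<kappa> * \<epsilon> \<le> 1" for \<epsilon>
    unfolding num_def
  proof (rule sum_infsum_upper_bound)
    show "0 < \<kappa> * \<epsilon>" using \<epsilon> kappa_pos by simp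
    fix k assume k: "\<bar>real_of_int k * (\<kappa> * \<epsilon>)\<bar> \<le> pi"
    let ?\<alpha> = "real_of_int k * (\<kappa> * \<epsilon>)" and ?M = "\<bar>c3\<bar> * (\<kappa> * \<epsilon>) powr (3 / 2)"
    let ?a = "(dirvec ?\<alpha> \<bullet> x0 - pbar) / \<epsilon>"
    have "(\<integral>\<omega>. \<bar>\<eta> \<epsilon> k j \<omega>\<bar> ^ 3 \<partial>P \<epsilon>) \<le> ?M" for j
      by (rule order_trans[OF N3[OF \<epsilon>(1) k]]) (intro mult_right_mono, auto)
    then have "(\<Sum>\<^sub>\<infinity>j. \<bar>G ?\<alpha> (?a - real_of_int j)\<bar> ^ 3 * (\<integral>\<omega>. \<bar>\<eta> \<epsilon> k j \<omega>\<bar> ^ 3 \<partial>P \<epsilon>))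
        \<le> C ^ 3 * ?M * W"
      by (intro conjunct2[OF W(2)[where a = ?a]] conjI mult_nonneg_nonneg power_decay[OF G_decay]) auto
    then show "(\<Sum>\<^sub>\<infinity>j. \<bar>G ?\<alpha> (?a - real_of_int j)\<bar> ^ 3 * (\<integral>\<omega>. \<bar>\<eta> \<epsilon> k j \<omega>\<bar> ^ 3 \<partial>P \<epsilon>))
        \<le> E * (\<kappa> * \<epsilon>) powr (3 / 2)"
      by (simp add: E_def mult_ac)
  qed (use \<epsilon> E in auto)
  have den_ge: "c * m\<^sup>2 * \<delta> \<le> den \<epsilon>"
    if \<epsilon>: "\<epsilon> > 0" "\<kappa> * \<epsilon> \<le> \<delta>" "\<epsilon> * (of_int J + 1) < \<delta>2" for \<epsilon>
    unfolding den_def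
  proof (rule sum_infsum_lower_bound[where \<tau> = \<alpha>0])
    show e: "0 < \<kappa> * \<epsilon>" using \<epsilon> kappa_pos by simp
    fix k assume k: "\<bar>real_of_int k * (\<kappa> * \<epsilon>) - \<alpha>0\<bar> \<le> \<delta>"
    let ?\<alpha> = "real_of_int k * (\<kappa> * \<epsilon>)"
    let ?a = "(dirvec ?\<alpha> \<bullet> x0 - pbar) / \<epsilon>"
    let ?p = "\<lambda>j. pbar + real_of_int j * \<epsilon>"
    let ?w = "\<lambda>j. (G ?\<alpha> (?a - real_of_int j))\<^sup>2 * (\<integral>\<omega>. (\<eta> \<epsilon> k j \<omega>)\<^sup>2 \<partial>P \<epsilon>)"
    have k': "\<bar>?\<alpha>\<bar> \<le> pi" using k \<delta>(4,5) by (auto simp: abs_le_iff)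
    have N2': "(\<integral>\<omega>. (\<eta> \<epsilon> k j \<omega>)\<^sup>2 \<partial>P \<epsilon>) = (\<sigma> ?\<alpha> (?p j))\<^sup>2 * (\<kappa> * \<epsilon>)" for j
      using N2[OF \<epsilon>(1) k'] by simp
    \<comment> \<open>This upper bound is there for summability: a divergent \<open>infsum\<close>
      would be 0 by convention and could not dominate its finite partial sums.\<close>
    have var_le: "(\<integral>\<omega>. (\<eta> \<epsilon> k j \<omega>)\<^sup>2 \<partial>P \<epsilon>) \<le> B\<^sup>2 * (\<kappa> * \<epsilon>)" for j
      unfolding N2' using B(1)[of ?\<alpha> "?p j"] e
      by (intro mult_right_mono) (auto simp: abs_le_square_iff[symmetric])
    have "?w j \<le> C\<^sup>2 * (B\<^sup>2 * (\<kappa> * \<epsilon>)) / (1 + (?a - real_of_int j)\<^sup>2)" for j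
      using power_decay[OF G_decay _ _ var_le, of 2 j ?\<alpha> "?a - real_of_int j"] by simp
    then have w_sum: "?w summable_on UNIV"
      by (intro conjunct1[OF W(2)[where a = ?a]] conjI mult_nonneg_nonneg) auto
    have "c * m\<^sup>2 * (\<kappa> * \<epsilon>) \<le>
        (\<Sum>j\<in>{\<lfloor>?a\<rfloor>-J..\<lfloor>?a\<rfloor>+J}. (G ?\<alpha> (?a - of_int j))\<^sup>2) * (m\<^sup>2 * (\<kappa> * \<epsilon>))"
      using G_low[of ?\<alpha> ?a] k \<delta>(2) e mult_right_mono[of c _ "m\<^sup>2 * (\<kappa> * \<epsilon>)"] by (simp add: mult.assoc)
    also have "\<dots> \<le> (\<Sum>j\<in>{\<lfloor>?a\<rfloor>-J..\<lfloor>?a\<rfloor>+J}. ?w j)"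
      unfolding sum_distrib_right
    proof (intro sum_mono mult_left_mono)
      fix j assume j: "j \<in> {\<lfloor>?a\<rfloor>-J..\<lfloor>?a\<rfloor>+J}"
      \<comment> \<open>Lattice points with index near \<open>?a\<close> are close to the curve, so
        \<open>\<sigma>\<close> is at least \<open>m\<close> in modulus there. The 1 in
        \<open>of_int J + 1\<close> accounts for the fractional part of \<open>?a\<close>.\<close>
      have "?p j - dirvec ?\<alpha> \<bullet> x0 = \<epsilon> * (real_of_int j - ?a)" using \<epsilon>(1) by (simp add: field_simps)
      moreover have "\<bar>real_of_int j - ?a\<bar> \<le> of_int J + 1"
      proof -
        have "real_of_int \<lfloor>?a\<rfloor> - of_int J \<le> real_of_int j" "real_of_int j \<le> real_of_int \<lfloor>?a\<rfloor> + of_int J"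
          using j by (auto simp flip: of_int_diff of_int_add)
        then show ?thesis using of_int_floor_le[of ?a] real_of_int_floor_add_one_gt[of ?a]
          unfolding abs_le_iff by linarith
      qed
      ultimately have "\<bar>?p j - dirvec ?\<alpha> \<bullet> x0\<bar> \<le> \<epsilon> * (of_int J + 1)"
        using \<epsilon>(1) by (simp add: abs_mult)
      then have "m \<le> \<bar>\<sigma> ?\<alpha> (?p j)\<bar>" using \<epsilon>(3) k \<delta>(3) by (intro \<delta>2(2)) auto
      then have "m\<^sup>2 \<le> (\<sigma> ?\<alpha> (?p j))\<^sup>2" using m power_mono[of m "\<bar>\<sigma> ?\<alpha> (?p j)\<bar>" 2] by simp
      then show "m\<^sup>2 * (\<kappa> * \<epsilon>) \<le> (\<integral>\<omega>. (\<eta> \<epsilon> k j \<omega>)\<^sup>2 \<partial>P \<epsilon>)"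
        unfolding N2' using e by (intro mult_right_mono) auto
    qed simp
    also have "\<dots> \<le> infsum ?w UNIV"
      by (intro finite_sum_le_infsum w_sum mult_nonneg_nonneg) auto
    finally show "c * m\<^sup>2 * (\<kappa> * \<epsilon>) \<le> infsum ?w UNIV" .
  qed (use \<epsilon> \<delta> c in auto)
  define d where "d = c * m\<^sup>2 * \<delta>"
  have d: "d > 0" using c m \<delta>(1) by (simp add: d_def)
  have "(\<lambda>\<epsilon>. num \<epsilon> / den \<epsilon> powr (3 / 2)) \<in> O[at_right 0](\<lambda>\<epsilon>. sqrt \<epsilon>)"
  proof (rule bigoI)
    have small: "eventually (\<lambda>\<epsilon>. \<epsilon> < b) (at_right 0)" if "b > 0" for b :: real
      using that by (intro order_tendstoD(2)[OF tendsto_ident_at])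
    have "eventually (\<lambda>\<epsilon>::real. \<epsilon> > 0) (at_right 0)" by (rule eventually_at_right_less)
    moreover have "eventually (\<lambda>\<epsilon>. \<epsilon> < 1 / \<kappa>) (at_right 0)" by (rule small) (use kappa_pos in simp)
    moreover have "eventually (\<lambda>\<epsilon>. \<epsilon> < \<delta> / \<kappa>) (at_right 0)"
      by (rule small) (use kappa_pos \<delta> in simp)
    moreover have "eventually (\<lambda>\<epsilon>. \<epsilon> < \<delta>2 / (of_int J + 1)) (at_right 0)"
      by (rule small) (use \<delta>2(1) J in simp)
    ultimately show "eventually (\<lambda>\<epsilon>. norm (num \<epsilon> / den \<epsilon> powr (3 / 2)) \<le>
        ((2 * pi + 1) * E * sqrt \<kappa> / d powr (3 / 2)) * norm (sqrt \<epsilon>)) (at_right 0)"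
    proof eventually_elim
      case (elim \<epsilon>)
      then have small': "\<kappa> * \<epsilon> \<le> 1" "\<kappa> * \<epsilon> \<le> \<delta>" "\<epsilon> * (of_int J + 1) < \<delta>2"
        using kappa_pos J by (auto simp: pos_less_divide_eq mult.commute)
      have dd: "d \<le> den \<epsilon>" unfolding d_def by (rule den_ge[OF elim(1) small'(2,3)])
      have "num \<epsilon> / den \<epsilon> powr (3 / 2) \<le> ((2 * pi + 1) * E * sqrt (\<kappa> * \<epsilon>)) / d powr (3 / 2)"
        \<comment> \<open>Chaining the two bounds shows that the upper bound of \<open>num\<close>
          is itself nonnegative, as \<open>frac_le\<close> demands.\<close>
        using order_trans[OF num_nonneg num_le[OF elim(1) small'(1)]] num_le[OF elim(1) small'(1)] d dd
        by (intro frac_le powr_mono2) auto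
      then show ?case using elim(1) num_nonneg[of \<epsilon>] by (simp add: real_sqrt_mult mult_ac)
    qed
  qed
  then show ?thesis unfolding num_def den_def G_def h_def .
qed

end
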